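(* Let $n\ge 1$ and $0\le r\le n$ be integers, and let $\lambda_0,\ldots,\lambda_n\ge 0$ and $\beta>0$ be real numbers. If every code $C\subseteq\mathbb{E}=\{0,1\}^n$ with covering radius $r$ satisfies $(\lambda_0,\ldots,\lambda_n)\beta$, then $$K_2(n,r)^3\ \ge\ \min_x\ 2^n\sum_{(i,j,t)\in I(2,n)}\binom{n}{i-t,\,j-t,\,t}x_{i,j}^t,$$ where the minimum ranges over all families of real numbers $x=(x_{i,j}^t)_{(i,j,t)\in I(2,n)}$ satisfying all of the following constraints. (A) For all $(i,j,t)\in I(2,n)$: $0\le x_{i,j}^t\le x_{i,i}^i$; $\ x_{i,0}^0+x_{i+j-2t,0}^0-x_{0,0}^0\le x_{i,j}^t\le x_{i+j-2t,0}^0$; and $x_{i,j}^t=x_{i',j'}^{t'}$ for every $(i',j',t')\in I(2,n)$ such that $(i,j,i+j-2t)$ is a permutation of $(i',j',i'+j'-2t')$. (B) For each $k=1,\ldots,\lfloor n/2\rfloor$: $\bigl(\sum_t\beta_{i,j,k}^t x_{i,j}^t\bigr)_{i,j=k}^{n-k}\succeq 0$ and $\bigl(\sum_t\beta_{i,j,k}^t(x_{i+j-2t,0}^0-x_{i,j}^t)\bigr)_{i,j=k}^{n-k}\succeq 0$. Moreover $\bigl(\sum_t\beta_{i,j,0}^t x_{i,j}^t\bigr)_{i,j=0}^n\succeq 0$ and $\begin{pmatrix}1-x_{0,0}^0&y^{\mathsf T}\\ y&L\end{pmatrix}\succeq 0$, where $L=\bigl(\sum_t\beta_{i,j,0}^t(x_{i+j-2t,0}^0-x_{i,j}^t)\bigr)_{i,j=0}^n$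 and $y_i=\binom ni(x_{0,0}^0-x_{i,0}^0)$ for $i=0,\ldots,n$. (C) Put $z_{i,j}^t=\Bigl(\sum_{d=0}^n\sum_{(i',j',t')\in I(2,n)}\lambda_d\,\eta_{(i',j',t'),d}^{(i,j,t)}\,x_{i',j'}^{t'}\Bigr)-\beta x_{i+j-2t,0}^0$ for $(i,j,t)\in I(2,n)$. Then $\bigl(\sum_t\beta_{i,j,k}^t z_{i,j}^t\bigr)_{i,j=k}^{n-k}\succeq 0$ for each $k=1,\ldots,\lfloor n/2\rfloor$, and $\begin{pmatrix}\sum_{i=0}^n\binom ni\lambda_i x_{0,0}^0-\beta&y^{\mathsf T}\\ y&T\end{pmatrix}\succeq 0$, where $T=\bigl(\sum_t\beta_{i,j,0}^t z_{i,j}^t\bigr)_{i,j=0}^n$ and $y_i=\binom ni z_{i,i}^i$ for $i=0,\ldots,n$. (D) For every $(i,j,t)\in I(2,n)$, with $\lambda_{j',t'}^{i,j,t}=\sum_{d=0}^n\lambda_d\,\alpha_{(i,j',t'),d}^{(i,j,t)}$ and with sums over all $j',t'$ such that $(i,j',t')\in I(2,n)$: $$\sum_{j',t'}x_{i,j'}^{t'}\lambda_{j',t'}^{i,j,t}\ge x_{i,0}^0\beta,$$ $$\sum_{j',t'}(x_{j',0}^0-x_{i,j'}^{t'})\lambda_{j',t'}^{i,j,t}\ge(x_{0,0}^0-x_{i,0}^0)\beta,$$ $$\sum_{j',t'}(x_{i+j'-2t',0}^0-x_{i,j'}^{t'})\lambda_{j',t'}^{i,j,t}\ge(x_{0,0}^0-x_{i,0}^0)\beta,$$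 $$\sum_{j',t'}(x_{0,0}^0-x_{j',0}^0-x_{i+j'-2t',0}^0+x_{i,j'}^{t'})\lambda_{j',t'}^{i,j,t}\ge(1-2x_{0,0}^0+x_{i,0}^0)\beta.$$
   Context: $\mathbb E=\{0,1\}^n$ is identified with $(\mathbb Z/2\mathbb Z)^n$. $d(\cdot,\cdot)$ is the Hamming distance, weight is distance to the zero word $\mathbf 0$, $S_i(\mathbf u)=\{\mathbf v: d(\mathbf u,\mathbf v)=i\}$, $B_r(\mathbf u)=\{\mathbf v:d(\mathbf u,\mathbf v)\le r\}$. The covering radius of $C\subseteq\mathbb E$ is the smallest integer $r$ with $\bigcup_{\mathbf u\in C}B_r(\mathbf u)=\mathbb E$; $K_2(n,r)$ is the minimum of $|C|$ over all $C\subseteq\mathbb E$ with covering radius $r$. $C$ satisfies $(\lambda_0,\ldots,\lambda_n)\beta$ if $\sum_{i=0}^n\lambda_i|C\cap S_i(\mathbf u)|\ge\beta$ for all $\mathbf u\in\mathbb E$. For $\mathbf u,\mathbf v\in\mathbb E$, $\overline d(\mathbf u,\mathbf v)=(i,j,t)$ with $i=|\{\ell:\mathbf u_\ell\ne0\}|$, $j=|\{\ell:\mathbf v_\ell\neq 0\}|$, $t=|\{\ell:\mathbf u_\ell\ne0,\mathbf v_\ell\ne0\}|$. $I(2,n)=\{(i,j,t): 0\le t\le i,j,\ i+j\le n+t\}$ (integers) is the set of triples that occur. $\beta_{i,j,k}^t=\sum_{u=0}^n(-1)^{t-u}\binom ut\binom{n-2k}{u-k}\binom{n-k-u}{i-u}\binom{n-k-u}{j-u}$,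 with the convention $\binom st=0$ if $s<t$ or $t<0$. Sums $\sum_t\beta_{i,j,k}^t(\cdots)$ run over all $t$ with $(i,j,t)\in I(2,n)$. The multinomial coefficient is $\binom{n}{a,b,c}=\frac{n!}{a!\,b!\,c!\,(n-a-b-c)!}$. For $\mathbf u,\mathbf v$ with $\overline d(\mathbf u,\mathbf v)=(i,j,t)$: $\eta_{(i',j',t'),d}^{(i,j,t)}$ is the number of $\mathbf w\in\mathbb E$ of weight $d$ with $\overline d(\mathbf u-\mathbf w,\mathbf v-\mathbf w)=(i',j',t')$; and $\alpha_{(i,j',t'),d}^{(i,j,t)}$ is the number of $\mathbf w\in\mathbb E$ with $\overline d(\mathbf u,\mathbf w)=(i,j',t')$ and $d(\mathbf v,\mathbf w)=d$. (Both depend only on $(i,j,t)$, not on the choice of $\mathbf u,\mathbf v$.) $\succeq0$ means positive semidefinite. *)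

theory Defs
  imports Complex_Main "HOL-Library.Z2" "HOL-Library.Multiset"
begin

text \<open>Words are functions on all of \<open>nat\<close> vanishing outside \<open>{..<n}\<close>, so that the subtraction of
  \<open>(\<int>/2\<int>)^n\<close> is the pointwise subtraction of functions.\<close>

definition words :: "nat \<Rightarrow> (nat \<Rightarrow> bit) set" where
  "words n = {u. \<forall>l\<ge>n. u l = 0}"

definition hamming :: "nat \<Rightarrow> (nat \<Rightarrow> bit) \<Rightarrow> (nat \<Rightarrow> bit) \<Rightarrow> nat" where
  "hamming n u v = card {l. l < n \<and> u l \<noteq> v l}"

definition weight :: "nat \<Rightarrow> (nat \<Rightarrow> bit) \<Rightarrow> nat" where
  "weight n u = hamming n u (\<lambda>_. 0)"

definition sphere_of :: "nat \<Rightarrow> nat \<Rightarrow> (nat \<Rightarrow> bit) \<Rightarrow> (nat \<Rightarrow> bit) set" where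
  "sphere_of n i u = {v \<in> words n. hamming n u v = i}"

definition ball_of :: "nat \<Rightarrow> nat \<Rightarrow> (nat \<Rightarrow> bit) \<Rightarrow> (nat \<Rightarrow> bit) set" where
  "ball_of n r u = {v \<in> words n. hamming n u v \<le> r}"

text \<open>A relation rather than a function, because the empty code has no covering radius.\<close>

definition has_covering_radius :: "nat \<Rightarrow> (nat \<Rightarrow> bit) set \<Rightarrow> nat \<Rightarrow> bool" where
  "has_covering_radius n C r \<longleftrightarrow>
     (\<Union>u\<in>C. ball_of n r u) = words n \<and> (\<forall>s<r. (\<Union>u\<in>C. ball_of n s u) \<noteq> words n)"

definition K2 :: "nat \<Rightarrow> nat \<Rightarrow> nat" where
  "K2 n r = Min (card ` {C. C \<subseteq> words n \<and> has_covering_radius n C r})"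

definition satisfies :: "nat \<Rightarrow> (nat \<Rightarrow> real) \<Rightarrow> real \<Rightarrow> (nat \<Rightarrow> bit) set \<Rightarrow> bool" where
  "satisfies n lam \<beta> C \<longleftrightarrow>
     (\<forall>u\<in>words n. (\<Sum>i=0..n. lam i * real (card (C \<inter> sphere_of n i u))) \<ge> \<beta>)"

definition dbar :: "nat \<Rightarrow> (nat \<Rightarrow> bit) \<Rightarrow> (nat \<Rightarrow> bit) \<Rightarrow> nat \<times> nat \<times> nat" where
  "dbar n u v = (card {l. l < n \<and> u l \<noteq> 0},
                 card {l. l < n \<and> v l \<noteq> 0},
                 card {l. l < n \<and> u l \<noteq> 0 \<and> v l \<noteq> 0})"

text \<open>On \<open>I2 n\<close> none of the natural-number differences \<open>i - t\<close>, \<open>j - t\<close>, \<open>i + j - 2 * t\<close>,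
  \<open>n - (i - t) - (j - t) - t\<close> truncates.\<close>

definition I2 :: "nat \<Rightarrow> (nat \<times> nat \<times> nat) set" where
  "I2 n = {(i, j, t). t \<le> i \<and> t \<le> j \<and> i + j \<le> n + t}"

text \<open>The binomial coefficient with integer arguments, zero if \<open>s < t\<close> or \<open>t < 0\<close>
  (so in particular whenever \<open>s < 0\<close>).\<close>

definition ibinom :: "int \<Rightarrow> int \<Rightarrow> real" where
  "ibinom s t = (if s < t \<or> t < 0 then 0 else real (nat s choose nat t))"

definition beta_coeff :: "nat \<Rightarrow> nat \<Rightarrow> nat \<Rightarrow> nat \<Rightarrow> nat \<Rightarrow> real" where
  "beta_coeff n i j k t =
     (\<Sum>u=0..n. (-1) powi (int t - int u) * ibinom (int u) (int t)
        * ibinom (int n - 2 * int k) (int u - int k)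
        * ibinom (int n - int k - int u) (int i - int u)
        * ibinom (int n - int k - int u) (int j - int u))"

definition multinom :: "nat \<Rightarrow> nat \<Rightarrow> nat \<Rightarrow> nat \<Rightarrow> real" where
  "multinom n a b c = fact n / (fact a * fact b * fact c * fact (n - a - b - c))"

text \<open>The next two numbers depend only on \<open>(i, j, t)\<close>, not on \<open>u, v\<close>; the definite description
  is meaningful for \<open>(i, j, t) \<in> I2 n\<close> only.\<close>

definition eta :: "nat \<Rightarrow> nat \<times> nat \<times> nat \<Rightarrow> nat \<times> nat \<times> nat \<Rightarrow> nat \<Rightarrow> nat" where
  "eta n ijt ijt' d =
     (THE m. \<forall>u\<in>words n. \<forall>v\<in>words n. dbar n u v = ijt \<longrightarrow>
        m = card {w \<in> words n. weight n w = d \<and> dbar n (u - w) (v - w) = ijt'})"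

definition alpha :: "nat \<Rightarrow> nat \<times> nat \<times> nat \<Rightarrow> nat \<times> nat \<times> nat \<Rightarrow> nat \<Rightarrow> nat" where
  "alpha n ijt ijt' d =
     (THE m. \<forall>u\<in>words n. \<forall>v\<in>words n. dbar n u v = ijt \<longrightarrow>
        m = card {w \<in> words n. dbar n u w = ijt' \<and> hamming n v w = d})"

text \<open>Positive semidefiniteness of the real symmetric matrix with rows and columns indexed by the
  finite set \<open>S\<close>.\<close>

definition psd_on :: "'a set \<Rightarrow> ('a \<Rightarrow> 'a \<Rightarrow> real) \<Rightarrow> bool" where
  "psd_on S A \<longleftrightarrow> (\<forall>i\<in>S. \<forall>j\<in>S. A i j = A j i) \<and>
     (\<forall>v. 0 \<le> (\<Sum>i\<in>S. \<Sum>j\<in>S. v i * A i j * v j))"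

text \<open>The block matrix with corner \<open>c\<close>, first row and first column \<open>y\<close>, and remaining block \<open>L\<close>;
  the index \<open>None\<close> stands for the additional row and column.\<close>

definition bordered :: "real \<Rightarrow> ('a \<Rightarrow> real) \<Rightarrow> ('a \<Rightarrow> 'a \<Rightarrow> real) \<Rightarrow> 'a option \<Rightarrow> 'a option \<Rightarrow> real" where
  "bordered c y L p q =
     (case p of
        None \<Rightarrow> (case q of None \<Rightarrow> c | Some j \<Rightarrow> y j)
      | Some i \<Rightarrow> (case q of None \<Rightarrow> y i | Some j \<Rightarrow> L i j))"

definition psd_bordered_on :: "'a set \<Rightarrow> real \<Rightarrow> ('a \<Rightarrow> real) \<Rightarrow> ('a \<Rightarrow> 'a \<Rightarrow> real) \<Rightarrow> bool" where
  "psd_bordered_on S c y L \<longleftrightarrow> psd_on (insert None (Some ` S)) (bordered c y L)"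

text \<open>A family \<open>(x\<^sub>i\<^sub>,\<^sub>j\<^sup>t)\<close> indexed by \<open>I2 n\<close> is a function \<open>x i j t\<close>; the objective and the constraints
  only involve its values on \<open>I2 n\<close>. The next definition is the \<open>(i, j)\<close> entry of the \<open>k\<close>-th block
  of such a family.\<close>

definition block :: "nat \<Rightarrow> (nat \<Rightarrow> nat \<Rightarrow> nat \<Rightarrow> real) \<Rightarrow> nat \<Rightarrow> nat \<Rightarrow> nat \<Rightarrow> real" where
  "block n x k i j = (\<Sum>t | (i, j, t) \<in> I2 n. beta_coeff n i j k t * x i j t)"

definition objective :: "nat \<Rightarrow> (nat \<Rightarrow> nat \<Rightarrow> nat \<Rightarrow> real) \<Rightarrow> real" where
  "objective n x = 2 ^ n * (\<Sum>(i, j, t)\<in>I2 n. multinom n (i - t) (j - t) t * x i j t)"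

definition constraint_A :: "nat \<Rightarrow> (nat \<Rightarrow> nat \<Rightarrow> nat \<Rightarrow> real) \<Rightarrow> bool" where
  "constraint_A n x \<longleftrightarrow>
     (\<forall>(i, j, t)\<in>I2 n.
        0 \<le> x i j t \<and> x i j t \<le> x i i i \<and>
        x i 0 0 + x (i + j - 2 * t) 0 0 - x 0 0 0 \<le> x i j t \<and>
        x i j t \<le> x (i + j - 2 * t) 0 0 \<and>
        (\<forall>(i', j', t')\<in>I2 n.
           {#i, j, i + j - 2 * t#} = {#i', j', i' + j' - 2 * t'#} \<longrightarrow> x i j t = x i' j' t'))"

definition compl_family ::
    "(nat \<Rightarrow> nat \<Rightarrow> nat \<Rightarrow> real) \<Rightarrow> nat \<Rightarrow> nat \<Rightarrow> nat \<Rightarrow> real" where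
  "compl_family x i j t = x (i + j - 2 * t) 0 0 - x i j t"

definition constraint_B :: "nat \<Rightarrow> (nat \<Rightarrow> nat \<Rightarrow> nat \<Rightarrow> real) \<Rightarrow> bool" where
  "constraint_B n x \<longleftrightarrow>
     (\<forall>k\<in>{1..n div 2}.
        psd_on {k..n - k} (block n x k) \<and>
        psd_on {k..n - k} (block n (compl_family x) k)) \<and>
     psd_on {0..n} (block n x 0) \<and>
     psd_bordered_on {0..n} (1 - x 0 0 0)
       (\<lambda>i. real (n choose i) * (x 0 0 0 - x i 0 0))
       (block n (compl_family x) 0)"

definition z_family ::
    "nat \<Rightarrow> (nat \<Rightarrow> real) \<Rightarrow> real \<Rightarrow> (nat \<Rightarrow> nat \<Rightarrow> nat \<Rightarrow> real) \<Rightarrow> nat \<Rightarrow> nat \<Rightarrow> nat \<Rightarrow> real" where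
  "z_family n lam \<beta> x i j t =
     (\<Sum>d=0..n. \<Sum>(i', j', t')\<in>I2 n.
        lam d * real (eta n (i, j, t) (i', j', t') d) * x i' j' t')
     - \<beta> * x (i + j - 2 * t) 0 0"

definition constraint_C ::
    "nat \<Rightarrow> (nat \<Rightarrow> real) \<Rightarrow> real \<Rightarrow> (nat \<Rightarrow> nat \<Rightarrow> nat \<Rightarrow> real) \<Rightarrow> bool" where
  "constraint_C n lam \<beta> x \<longleftrightarrow>
     (let z = z_family n lam \<beta> x in
        (\<forall>k\<in>{1..n div 2}. psd_on {k..n - k} (block n z k)) \<and>
        psd_bordered_on {0..n}
          ((\<Sum>i=0..n. real (n choose i) * lam i * x 0 0 0) - \<beta>)
          (\<lambda>i. real (n choose i) * z i i i)
          (block n z 0))"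

text \<open>The coefficient \<open>\<lambda>\<close> with lower indices \<open>j', t'\<close> and upper indices \<open>i, j, t\<close>.\<close>

definition lam_coeff ::
    "nat \<Rightarrow> (nat \<Rightarrow> real) \<Rightarrow> nat \<Rightarrow> nat \<Rightarrow> nat \<Rightarrow> nat \<Rightarrow> nat \<Rightarrow> real" where
  "lam_coeff n lam i j t j' t' = (\<Sum>d=0..n. lam d * real (alpha n (i, j, t) (i, j', t') d))"

definition constraint_D ::
    "nat \<Rightarrow> (nat \<Rightarrow> real) \<Rightarrow> real \<Rightarrow> (nat \<Rightarrow> nat \<Rightarrow> nat \<Rightarrow> real) \<Rightarrow> bool" where
  "constraint_D n lam \<beta> x \<longleftrightarrow>
     (\<forall>(i, j, t)\<in>I2 n. let J = {(j', t'). (i, j', t') \<in> I2 n}; l = lam_coeff n lam i j t in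
        (\<Sum>(j', t')\<in>J. x i j' t' * l j' t') \<ge> x i 0 0 * \<beta> \<and>
        (\<Sum>(j', t')\<in>J. (x j' 0 0 - x i j' t') * l j' t') \<ge> (x 0 0 0 - x i 0 0) * \<beta> \<and>
        (\<Sum>(j', t')\<in>J. (x (i + j' - 2 * t') 0 0 - x i j' t') * l j' t')
          \<ge> (x 0 0 0 - x i 0 0) * \<beta> \<and>
        (\<Sum>(j', t')\<in>J. (x 0 0 0 - x j' 0 0 - x (i + j' - 2 * t') 0 0 + x i j' t') * l j' t')
          \<ge> (1 - 2 * x 0 0 0 + x i 0 0) * \<beta>)"

definition feasible ::
    "nat \<Rightarrow> (nat \<Rightarrow> real) \<Rightarrow> real \<Rightarrow> (nat \<Rightarrow> nat \<Rightarrow> nat \<Rightarrow> real) \<Rightarrow> bool" where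
  "feasible n lam \<beta> x \<longleftrightarrow>
     constraint_A n x \<and> constraint_B n x \<and> constraint_C n lam \<beta> x \<and> constraint_D n lam \<beta> x"

end

theory Submission
  imports Defs "HOL-Combinatorics.Permutations" "HOL-Analysis.Function_Topology"
begin

text \<open>Let \<open>C\<close> be a code with covering radius \<open>r\<close> and \<open>|C| = K2 n r\<close>, and let \<open>x i j t\<close> be the
  probability that a uniformly random isometry of the Hamming cube maps the three words \<open>0\<close>, \<open>u\<close>, \<open>v\<close>
  into \<open>C\<close>, where \<open>dbar n u v = (i, j, t)\<close>. Then \<open>objective n x = |C|^3\<close>. The linear constraints
  are pointwise inequalities for the indicator function \<open>\<chi>\<close> of the random preimage of \<open>C\<close>, and each
  of the \<open>2^n \<times> 2^n\<close> matrices behind the semidefinite constraints is an expectation of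
  \<open>q \<chi> \<chi>\<^sup>T\<close> with a random variable \<open>q \<ge> 0\<close>. The \<open>k\<close>-th block is, up to a positive factor, the
  compression of such a matrix to the vectors (one for each weight \<open>i\<close>) that are supported on the
  words of weight \<open>i\<close> and equal there to a product of \<open>k\<close> differences of disjoint pairs of coordinates.
  The minimum exists because the feasible set is closed and, on \<open>I2 n\<close>, bounded.\<close>

section \<open>Words and isometries\<close>

text \<open>Positivity of a compression is inherited from the whole matrix, so the burden lies in
  matching \<open>beta_coeff\<close> with the compression exactly. A product of \<open>k\<close>
  differences is nonzero only on words that choose one coordinate of each pair, which forces weights
  in \<open>{k..n - k}\<close>; \<open>beta_coeff\<close> is, up to the factor \<open>2 ^ k\<close>,
  the sum of products of two such values over the pairs of sets that meet in \<open>t\<close>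
  points. The variables \<open>q\<close> are \<open>\<chi>\<close> at the zero word for
  \<open>x\<close>, its complement to 1 for \<open>compl_family x\<close>, and for
  \<open>z_family\<close> the excess of the covering inequality at the zero word. A border arises by
  adjoining the constant 1 to the vector \<open>\<chi>\<close>. Constraint (D) multiplies the
  covering inequality at \<open>v\<close> by \<open>\<chi>\<close> or \<open>1 - \<chi>\<close> at
  zero and at \<open>u\<close>. Averaging over translations as well as coordinate permutations makes
  the probability of a triple of words depend only on its three mutual distances. This yields the
  permutation symmetry in (A), and the factor \<open>2 ^ n\<close> of the objective, since every
  single word is hit with probability \<open>|C| / 2 ^ n\<close>.\<close>

lemma card_Collect_bij_betw:
  assumes "bij_betw f A B" "\<And>w. w \<in> A \<Longrightarrow> P (f w) \<longleftrightarrow> Q w"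
  shows "card {w \<in> B. P w} = card {w \<in> A. Q w}"
proof -
  have "bij_betw f {w \<in> A. Q w} {w \<in> B. P w}"
    by (rule bij_betw_subset[OF assms(1)]) (use assms in \<open>auto simp: bij_betw_def\<close>)
  then show ?thesis by (simp add: bij_betw_same_card)
qed

definition word_of :: "nat set \<Rightarrow> nat \<Rightarrow> bit" where
  "word_of A = (\<lambda>l. of_bool (l \<in> A))"

abbreviation zero_word :: "nat \<Rightarrow> bit" where
  "zero_word \<equiv> \<lambda>_. 0"

lemma bij_betw_word_of: "bij_betw word_of (Pow {..<n}) (words n)"
proof (rule bij_betw_byWitness[where f' = "\<lambda>u. {l. u l = 1}"])
  show "\<forall>u\<in>words n. word_of {l. u l = 1} = u"
    by (auto simp: word_of_def fun_eq_iff)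
qed (auto simp: word_of_def words_def, metis not_le zero_neq_one)

lemma finite_words [simp]: "finite (words n)"
  using bij_betw_finite[OF bij_betw_word_of] by simp

lemma card_words: "card (words n) = 2 ^ n"
  using bij_betw_same_card[OF bij_betw_word_of, of n] by (simp add: card_Pow)

lemma word_of_in_words: "A \<subseteq> {..<n} \<Longrightarrow> word_of A \<in> words n"
  using bij_betw_word_of by (auto simp: bij_betw_def)

lemma zero_in_words [simp]: "zero_word \<in> words n"
  by (simp add: words_def)

lemma diff_in_words [simp]: "u \<in> words n \<Longrightarrow> v \<in> words n \<Longrightarrow> u - v \<in> words n"
  by (simp add: words_def fun_diff_def)

lemma word_diff_zero [simp]: "u - zero_word = u" for u :: "nat \<Rightarrow> bit"
  by (simp add: fun_eq_iff)

lemma word_diff_self [simp]: "u - u = zero_word" for u :: "nat \<Rightarrow> bit"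
proof
  show "(u - u) l = 0" for l by (cases "u l") simp_all
qed

lemma dbar_word_of:
  assumes "A \<subseteq> {..<n}" "B \<subseteq> {..<n}"
  shows "dbar n (word_of A) (word_of B) = (card A, card B, card (A \<inter> B))"
proof -
  have "{l. l < n \<and> word_of A l \<noteq> 0} = A" "{l. l < n \<and> word_of B l \<noteq> 0} = B"
    "{l. l < n \<and> word_of A l \<noteq> 0 \<and> word_of B l \<noteq> 0} = A \<inter> B"
    using assms by (auto simp: word_of_def)
  then show ?thesis by (simp add: dbar_def)
qed

lemma dbar_in_I2: "dbar n u v \<in> I2 n"
proof -
  let ?U = "{l. l < n \<and> u l \<noteq> 0}" and ?V = "{l. l < n \<and> v l \<noteq> 0}"
  have "card ?U + card ?V = card (?U \<union> ?V) + card (?U \<inter> ?V)"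
    by (rule card_Un_Int) auto
  moreover have "card (?U \<union> ?V) \<le> card {..<n}" by (rule card_mono) auto
  moreover have "card (?U \<inter> ?V) \<le> card ?U" "card (?U \<inter> ?V) \<le> card ?V"
    by (auto intro: card_mono)
  moreover have "?U \<inter> ?V = {l. l < n \<and> u l \<noteq> 0 \<and> v l \<noteq> 0}" by auto
  ultimately show ?thesis by (simp add: dbar_def I2_def)
qed

lemma I2_witness:
  assumes "(i, j, t) \<in> I2 n"
  obtains A B where "A \<subseteq> {..<n}" "B \<subseteq> {..<n}" "card A = i" "card B = j" "card (A \<inter> B) = t"
proof (rule that)
  from assms have *: "t \<le> i" "t \<le> j" "i + j \<le> n + t" by (auto simp: I2_def)
  \<comment> \<open>The second interval has length \<open>j\<close> and begins \<open>t\<close>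
    places before the end of the first; it fits because \<open>i + j - t \<le> n\<close> is the last
    condition of \<open>I2\<close>.\<close>
  then show "{..<i} \<subseteq> {..<n}" "{i - t..<i + j - t} \<subseteq> {..<n}"
    "card {i - t..<i + j - t} = j" by auto
  have "{..<i} \<inter> {i - t..<i + j - t} = {i - t..<i}" using * by auto
  then show "card ({..<i} \<inter> {i - t..<i + j - t}) = t" using * by simp
qed simp

lemma I2_dbar_witness:
  assumes "(i, j, t) \<in> I2 n"
  obtains u v where "u \<in> words n" "v \<in> words n" "dbar n u v = (i, j, t)"
  using I2_witness[OF assms] by (metis dbar_word_of word_of_in_words)

lemma finite_I2 [simp]: "finite (I2 n)"
  by (rule finite_subset[of _ "{..n} \<times> {..n} \<times> {..n}"]) (auto simp: I2_def)

lemma dbar_swap: "dbar n u v = (i, j, t) \<longleftrightarrow> dbar n v u = (j, i, t)"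
  by (auto simp: dbar_def conj_commute)

lemma hamming_dbar:
  assumes "dbar n u v = (i, j, t)"
  shows "hamming n u v + 2 * t = i + j"
proof -
  let ?U = "{l. l < n \<and> u l \<noteq> 0}" and ?V = "{l. l < n \<and> v l \<noteq> 0}"
  have uv: "u l \<noteq> v l \<longleftrightarrow> (u l \<noteq> 0 \<longleftrightarrow> v l = 0)" for l by (cases "u l"; cases "v l") auto
  have "card ?U = card (?U - ?V) + card (?U \<inter> ?V)" "card ?V = card (?V - ?U) + card (?U \<inter> ?V)"
    by (subst card_Un_disjoint[symmetric]; auto intro: arg_cong[where f = card])+
  moreover have "card ((?U - ?V) \<union> (?V - ?U)) = card (?U - ?V) + card (?V - ?U)"
    by (rule card_Un_disjoint) auto
  moreover have "(?U - ?V) \<union> (?V - ?U) = {l. l < n \<and> u l \<noteq> v l}"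
    by (auto simp: uv)
  moreover have "?U \<inter> ?V = {l. l < n \<and> u l \<noteq> 0 \<and> v l \<noteq> 0}" by auto
  ultimately show ?thesis using assms by (auto simp: dbar_def hamming_def)
qed

lemma hamming_diff_words: "hamming n (u - w) (v - w) = hamming n u v"
proof -
  have "u l - w l = v l - w l \<longleftrightarrow> u l = v l" for l
    by (cases "u l"; cases "v l"; cases "w l") auto
  then show ?thesis by (simp add: hamming_def)
qed

lemma weight_diff: "weight n (u - v) = hamming n u v"
  using hamming_diff_words[of n u v v] by (simp add: weight_def)

lemma hamming_commute: "hamming n u v = hamming n v u"
  unfolding hamming_def by (metis)

lemma dbar_weight: "dbar n u v = (i, j, t) \<Longrightarrow> weight n u = i \<and> weight n v = j"
  by (auto simp: dbar_def weight_def hamming_def)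

text \<open>A triple carries the same information as the three mutual distances of the zero word,
  \<open>u\<close> and \<open>v\<close>; in this form the symmetry under permuting the three words
  is visible. The equation is additive so that no natural-number subtraction can truncate.\<close>

lemma dbar_eq_iff_hamming:
  "dbar n u v = (i, j, t) \<longleftrightarrow> weight n u = i \<and> weight n v = j \<and> hamming n u v + 2 * t = i + j"
proof
  assume "dbar n u v = (i, j, t)"
  then show "weight n u = i \<and> weight n v = j \<and> hamming n u v + 2 * t = i + j"
    using hamming_dbar dbar_weight by blast
next
  assume *: "weight n u = i \<and> weight n v = j \<and> hamming n u v + 2 * t = i + j"
  obtain i' j' t' where d: "dbar n u v = (i', j', t')" by (cases "dbar n u v")
  with dbar_weight[OF d] hamming_dbar[OF d] * show "dbar n u v = (i, j, t)" by auto
qed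

lemma hamming_le: "hamming n u v \<le> n"
  using card_mono[of "{..<n}" "{l. l < n \<and> u l \<noteq> v l}"] by (auto simp: hamming_def)

lemma card_words_weight: "card {u \<in> words n. weight n u = i} = n choose i"
proof -
  have w: "weight n (word_of A) = card A" if "A \<subseteq> {..<n}" for A
    using dbar_weight[OF dbar_word_of[OF that that]] by simp
  have "card {u \<in> words n. weight n u = i} = card {A \<in> Pow {..<n}. card A = i}"
    by (rule card_Collect_bij_betw[OF bij_betw_word_of]) (auto simp: w)
  then show ?thesis by (simp add: n_subsets)
qed

text \<open>A triple determines how many coordinates carry each of the four values of
  \<open>(u l, v l)\<close>. Equal counts mean equal multisets of columns, and these are matched by
  a permutation of the coordinates.\<close>

lemma dbar_eq_imp_permutes:
  assumes u: "u \<in> words n" "v \<in> words n" "u' \<in> words n" "v' \<in> words n"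
    and d: "dbar n u v = dbar n u' v'"
  obtains \<pi> where "\<pi> permutes {..<n}" "u' = u \<circ> \<pi>" "v' = v \<circ> \<pi>"
proof -
  define c where "c u v a b = card {l \<in> {..<n}. (u l, v l) = (a, b)}"
    for u v :: "nat \<Rightarrow> bit" and a b :: bit
  have c: "dbar n u v = (c u v 1 1 + c u v 1 0, c u v 1 1 + c u v 0 1, c u v 1 1) \<and>
      n = c u v 1 1 + c u v 1 0 + c u v 0 1 + c u v 0 0" for u v
  proof -
    let ?S = "\<lambda>a b. {l \<in> {..<n}. (u l, v l) = (a, b)}"
    have "card {l. l < n \<and> u l \<noteq> 0} = card (?S 1 1 \<union> ?S 1 0)"
      by (rule arg_cong[where f = card]) (auto simp flip: bit_not_zero_iff)
    moreover have "card {l. l < n \<and> v l \<noteq> 0} = card (?S 1 1 \<union> ?S 0 1)"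
      by (rule arg_cong[where f = card]) (auto simp flip: bit_not_zero_iff)
    moreover have "card {..<n} = card (?S 1 1 \<union> ?S 1 0 \<union> ?S 0 1 \<union> ?S 0 0)"
      by (rule arg_cong[where f = card]) (auto simp flip: bit_not_zero_iff)
    moreover have "card {l. l < n \<and> u l \<noteq> 0 \<and> v l \<noteq> 0} = card (?S 1 1)"
      by (rule arg_cong[where f = card]) auto
    moreover have "card (?S 1 1 \<union> ?S 1 0) = c u v 1 1 + c u v 1 0"
      "card (?S 1 1 \<union> ?S 0 1) = c u v 1 1 + c u v 0 1"
      unfolding c_def by (subst card_Un_disjoint; auto)+
    moreover have "card (?S 1 1 \<union> ?S 1 0 \<union> ?S 0 1 \<union> ?S 0 0)
        = c u v 1 1 + c u v 1 0 + c u v 0 1 + c u v 0 0"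
      unfolding c_def by (subst card_Un_disjoint; (subst card_Un_disjoint)?; (subst card_Un_disjoint)?; auto)
    ultimately show ?thesis unfolding dbar_def by (simp add: c_def)
  qed
  from c[of u v] c[of u' v'] d have
    "c u v 1 1 = c u' v' 1 1" "c u v 1 0 = c u' v' 1 0" "c u v 0 1 = c u' v' 0 1"
      "c u v 0 0 = c u' v' 0 0"
    by auto
  then have "c u v a b = c u' v' a b" for a b
    by (cases a; cases b) simp_all
  then have "image_mset (\<lambda>l. (u' l, v' l)) (mset_set {..<n}) = image_mset (\<lambda>l. (u l, v l)) (mset_set {..<n})"
    by (intro multiset_eqI) (auto simp: count_image_mset_eq_card_vimage c_def split: prod.split)
  then obtain \<pi> where \<pi>: "\<pi> permutes {..<n}" "\<forall>l\<in>{..<n}. (u' l, v' l) = (u (\<pi> l), v (\<pi> l))"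
    by (rule image_mset_eq_implies_permutes[rotated]) auto
  have "u' l = u (\<pi> l) \<and> v' l = v (\<pi> l)" for l
  proof (cases "l < n")
    case False
    with \<pi>(1) have "\<pi> l = l" by (auto simp: permutes_def)
    with False u show ?thesis by (auto simp: words_def)
  qed (use \<pi>(2) in auto)
  with \<pi>(1) that[of \<pi>] show thesis by (auto simp: fun_eq_iff)
qed

section \<open>Invariance under coordinate permutations; well-definedness of \<open>eta\<close> and
  \<open>alpha\<close>\<close>

lemma comp_permutes_in_words: "u \<in> words n \<Longrightarrow> \<pi> permutes {..<n} \<Longrightarrow> u \<circ> \<pi> \<in> words n"
  by (auto simp: words_def permutes_def)

lemma card_permuted:
  assumes "\<pi> permutes {..<n}"
  shows "card {l. l < n \<and> P (\<pi> l)} = card {l. l < n \<and> P l}"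
proof -
  have "bij_betw \<pi> {l. l < n \<and> P (\<pi> l)} {l. l < n \<and> P l}"
    using permutes_imp_bij[OF assms] by (auto simp: bij_betw_def inj_on_def image_iff) 
  then show ?thesis by (rule bij_betw_same_card)
qed

lemma dbar_permuted: "\<pi> permutes {..<n} \<Longrightarrow> dbar n (u \<circ> \<pi>) (v \<circ> \<pi>) = dbar n u v"
  unfolding dbar_def using card_permuted[of \<pi> n "\<lambda>l. u l \<noteq> 0"] card_permuted[of \<pi> n "\<lambda>l. v l \<noteq> 0"]
    card_permuted[of \<pi> n "\<lambda>l. u l \<noteq> 0 \<and> v l \<noteq> 0"] by simp

lemma hamming_permuted: "\<pi> permutes {..<n} \<Longrightarrow> hamming n (u \<circ> \<pi>) (v \<circ> \<pi>) = hamming n u v"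
  unfolding hamming_def using card_permuted[of \<pi> n "\<lambda>l. u l \<noteq> v l"] by simp

lemma bij_betw_comp_permutes:
  assumes "\<pi> permutes {..<n}"
  shows "bij_betw (\<lambda>u. u \<circ> \<pi>) (words n) (words n)"
proof (rule bij_betw_byWitness[where f' = "\<lambda>u. u \<circ> inv \<pi>"])
  show "\<forall>u\<in>words n. u \<circ> \<pi> \<circ> inv \<pi> = u" "\<forall>u\<in>words n. u \<circ> inv \<pi> \<circ> \<pi> = u"
    using assms by (auto simp: comp_assoc permutes_inv_o)
qed (use assms in \<open>auto intro: comp_permutes_in_words permutes_inv\<close>)

text \<open>The permutation that carries one pair of type \<open>ijt\<close> to another also
  transports the words \<open>w\<close> that are counted, preserving their weight and the types of
  the differences. The count is therefore the same for every pair, and the definite description can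
  be evaluated at any of them.\<close>

lemma eta_eq:
  assumes "u \<in> words n" "v \<in> words n" "dbar n u v = ijt"
  shows "eta n ijt ijt' d = card {w \<in> words n. weight n w = d \<and> dbar n (u - w) (v - w) = ijt'}"
  unfolding eta_def
proof (rule the_equality)
  show "\<forall>u'\<in>words n. \<forall>v'\<in>words n. dbar n u' v' = ijt \<longrightarrow>
      card {w \<in> words n. weight n w = d \<and> dbar n (u - w) (v - w) = ijt'}
      = card {w \<in> words n. weight n w = d \<and> dbar n (u' - w) (v' - w) = ijt'}"
  proof (intro ballI impI)
    fix u' v' assume "u' \<in> words n" "v' \<in> words n" "dbar n u' v' = ijt"
    with assms obtain \<pi> where \<pi>: "\<pi> permutes {..<n}" "u' = u \<circ> \<pi>" "v' = v \<circ> \<pi>"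
      by (metis dbar_eq_imp_permutes)
    have "weight n (w \<circ> \<pi>) = weight n w" for w
      using hamming_permuted[OF \<pi>(1), of w zero_word] by (simp add: weight_def comp_def)
    moreover have "dbar n (u' - (w \<circ> \<pi>)) (v' - (w \<circ> \<pi>)) = dbar n (u - w) (v - w)" for w
    proof -
      have "u' - (w \<circ> \<pi>) = (u - w) \<circ> \<pi>" "v' - (w \<circ> \<pi>) = (v - w) \<circ> \<pi>"
        by (simp_all only: \<pi> comp_def fun_diff_def)
      then show ?thesis by (simp only: dbar_permuted[OF \<pi>(1)])
    qed
    ultimately have *: "weight n (w \<circ> \<pi>) = d \<and> dbar n (u' - (w \<circ> \<pi>)) (v' - (w \<circ> \<pi>)) = ijt'
        \<longleftrightarrow> weight n w = d \<and> dbar n (u - w) (v - w) = ijt'" for w by simp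
    show "card {w \<in> words n. weight n w = d \<and> dbar n (u - w) (v - w) = ijt'}
      = card {w \<in> words n. weight n w = d \<and> dbar n (u' - w) (v' - w) = ijt'}"
      by (rule card_Collect_bij_betw[OF bij_betw_comp_permutes[OF \<pi>(1)], symmetric]) (rule *)
  qed
qed (use assms in auto)

lemma alpha_eq:
  assumes "u \<in> words n" "v \<in> words n" "dbar n u v = ijt"
  shows "alpha n ijt ijt' d = card {w \<in> words n. dbar n u w = ijt' \<and> hamming n v w = d}"
  unfolding alpha_def
proof (rule the_equality)
  show "\<forall>u'\<in>words n. \<forall>v'\<in>words n. dbar n u' v' = ijt \<longrightarrow>
      card {w \<in> words n. dbar n u w = ijt' \<and> hamming n v w = d}
      = card {w \<in> words n. dbar n u' w = ijt' \<and> hamming n v' w = d}"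
  proof (intro ballI impI)
    fix u' v' assume "u' \<in> words n" "v' \<in> words n" "dbar n u' v' = ijt"
    with assms obtain \<pi> where \<pi>: "\<pi> permutes {..<n}" "u' = u \<circ> \<pi>" "v' = v \<circ> \<pi>"
      by (metis dbar_eq_imp_permutes)
    have *: "dbar n u' (w \<circ> \<pi>) = ijt' \<and> hamming n v' (w \<circ> \<pi>) = d
        \<longleftrightarrow> dbar n u w = ijt' \<and> hamming n v w = d" for w
      by (simp add: \<pi> dbar_permuted hamming_permuted)
    show "card {w \<in> words n. dbar n u w = ijt' \<and> hamming n v w = d}
      = card {w \<in> words n. dbar n u' w = ijt' \<and> hamming n v' w = d}"
      by (rule card_Collect_bij_betw[OF bij_betw_comp_permutes[OF \<pi>(1)], symmetric]) (rule *)
  qed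
qed (use assms in auto)

section \<open>The coefficients of the block diagonalization\<close>

text \<open>Since \<open>(m choose u) * (u choose t) = (m choose t) * ((m - t) choose (u -
  t))\<close>, the sum is \<open>m choose t\<close> times an alternating sum of a full binomial row,
  which vanishes unless \<open>m = t\<close>.\<close>

lemma binomial_inversion_delta:
  assumes "m \<le> n"
  shows "(\<Sum>u=0..n. (-1) powi (int t - int u) * real (u choose t) * real (m choose u)) = of_bool (t = m)"
proof (cases "t \<le> m")
  case False
  then have "real (u choose t) * real (m choose u) = 0" for u
    using False by (cases "u < t") auto
  then show ?thesis using False
    by (simp only: mult.assoc) simp
next
  case True
  define f :: "nat \<Rightarrow> real"
    where "f u = (-1) powi (int t - int u) * real (u choose t) * real (m choose u)" for u
  have "sum f {0..n} = sum f {t..m}"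
    using assms by (intro sum.mono_neutral_right) (auto simp: f_def not_le)
  also have "\<dots> = sum f ((+) t ` {0..m - t})"
    using True by simp
  also have "\<dots> = (\<Sum>w=0..m - t. f (t + w))"
    by (subst sum.reindex) (auto simp: inj_on_def)
  also have "\<dots> = (\<Sum>w=0..m - t. real (m choose t) * ((-1) ^ w * real ((m - t) choose w)))"
  proof (rule sum.cong)
    fix w assume "w \<in> {0..m - t}"
    then have w: "t \<le> t + w" "t + w \<le> m" using True by auto
    have "(m choose (t + w)) * ((t + w) choose t) = (m choose t) * ((m - t) choose w)"
      using choose_mult[OF w] by simp
    then have "real (m choose (t + w)) * real ((t + w) choose t) = real (m choose t) * real ((m - t) choose w)"
      by (metis of_nat_mult)
    moreover have "(-1 :: real) powi (int t - int (t + w)) = (-1) ^ w"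
      by (simp add: power_int_minus flip: power_inverse)
    ultimately show "f (t + w) = real (m choose t) * ((-1) ^ w * real ((m - t) choose w))"
      by (simp add: f_def mult_ac)
  qed simp
  also have "\<dots> = real (m choose t) * (\<Sum>w\<le>m - t. (-1) ^ w * real ((m - t) choose w))"
    by (simp add: sum_distrib_left atLeast0AtMost)
  also have "\<dots> = of_bool (t = m)"
  proof (cases "t = m")
    case False
    with True have "m - t > 0" by simp
    from choose_alternating_sum[OF this, where 'a = real] False show ?thesis by simp
  qed simp
  finally show ?thesis by (simp add: f_def)
qed

text \<open>As a function of the characteristic vector this is the product of the differences of the
  coordinates \<open>2 * l\<close> and \<open>2 * l + 1\<close>, the Specht polynomial of the
  two-row shape \<open>(n - k, k)\<close>. Its values are 0, 1 and -1.\<close>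

definition pair_sign :: "nat \<Rightarrow> nat set \<Rightarrow> real" where
  "pair_sign k A = (\<Prod>l<k. of_bool (2 * l \<in> A) - of_bool (Suc (2 * l) \<in> A))"

definition transversal :: "nat \<Rightarrow> nat set \<Rightarrow> bool" where
  "transversal k A \<longleftrightarrow> (\<forall>l<k. 2 * l \<in> A \<longleftrightarrow> Suc (2 * l) \<notin> A)"

lemma pair_sign_eq_0_iff: "pair_sign k A = 0 \<longleftrightarrow> \<not> transversal k A"
  by (auto simp: pair_sign_def transversal_def)

lemma pair_sign_square: "transversal k A \<Longrightarrow> pair_sign k A * pair_sign k A = 1"
  unfolding pair_sign_def prod.distrib[symmetric]
  by (rule prod.neutral) (auto simp: transversal_def)

lemma even_odd_decomp:
  fixes x k :: nat
  assumes "x < 2 * k"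
  obtains l where "l < k" "x = 2 * l \<or> x = Suc (2 * l)"
proof (rule that)
  show "x div 2 < k" using assms by auto
  show "x = 2 * (x div 2) \<or> x = Suc (2 * (x div 2))" by presburger
qed

text \<open>\<open>U\<close> already owns one point of each pair and \<open>A\<close> has no room
  for the other. Hence all supersets of \<open>U\<close> with nonzero sign share the sign of
  \<open>U\<close> and differ from it only from coordinate \<open>2 * k\<close> on.\<close>

lemma transversal_subset_eq:
  assumes "transversal k A" "transversal k U" "U \<subseteq> A"
  shows "A \<inter> {..<2 * k} = U \<inter> {..<2 * k}"
proof -
  have "x \<in> U" if x: "x \<in> A" "x < 2 * k" for x
  proof -
    obtain l where "l < k" "x = 2 * l \<or> x = Suc (2 * l)"
      using even_odd_decomp[OF x(2)] .
    with assms x show ?thesis by (auto simp: transversal_def)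
  qed
  with assms(3) show ?thesis by auto
qed

lemma pair_sign_cong: "A \<inter> {..<2 * k} = B \<inter> {..<2 * k} \<Longrightarrow> pair_sign k A = pair_sign k B"
  unfolding pair_sign_def
proof (intro prod.cong refl)
  fix l assume e: "A \<inter> {..<2 * k} = B \<inter> {..<2 * k}" and "l \<in> {..<k}"
  then have "2 * l \<in> {..<2 * k}" "Suc (2 * l) \<in> {..<2 * k}" by auto
  with e have "2 * l \<in> A \<longleftrightarrow> 2 * l \<in> B" "Suc (2 * l) \<in> A \<longleftrightarrow> Suc (2 * l) \<in> B" by blast+
  then show "of_bool (2 * l \<in> A) - of_bool (Suc (2 * l) \<in> A)
      = (of_bool (2 * l \<in> B) - of_bool (Suc (2 * l) \<in> B) :: real)"
    by simp
qed

lemma transversal_cong: "A \<inter> {..<2 * k} = B \<inter> {..<2 * k} \<Longrightarrow> transversal k A = transversal k B"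
  by (metis pair_sign_cong pair_sign_eq_0_iff)

lemma card_transversal:
  assumes "transversal k A"
  shows "card (A \<inter> {..<2 * k}) = k"
proof -
  have "bij_betw (\<lambda>x. x div 2) (A \<inter> {..<2 * k}) {..<k}"
  proof (intro bij_betwI')
    fix x y assume xy: "x \<in> A \<inter> {..<2 * k}" "y \<in> A \<inter> {..<2 * k}"
    then obtain l m where l: "l < k" "x = 2 * l \<or> x = Suc (2 * l)"
      and m: "m < k" "y = 2 * m \<or> y = Suc (2 * m)"
      by (metis IntD2 lessThan_iff even_odd_decomp)
    then have "x div 2 = l" "y div 2 = m" by auto
    moreover have "x = y" if "l = m"
      using assms xy l m that unfolding transversal_def by blast
    ultimately show "x div 2 = y div 2 \<longleftrightarrow> x = y" by auto
  next
    fix l assume "l \<in> {..<k}"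
    with assms have "2 * l \<in> A \<inter> {..<2 * k} \<or> Suc (2 * l) \<in> A \<inter> {..<2 * k}"
      by (auto simp: transversal_def)
    then show "\<exists>x\<in>A \<inter> {..<2 * k}. l = x div 2"
      by (elim disjE) (auto intro!: bexI)
  qed auto
  then show ?thesis
    by (auto dest: bij_betw_same_card)
qed

lemma card_transversal_split:
  assumes "transversal k U" "U \<subseteq> {..<n}"
  shows "card U = k + card (U \<inter> {2 * k..<n})"
proof -
  have "finite U" using assms(2) finite_subset by blast
  then have "card ((U \<inter> {..<2 * k}) \<union> (U \<inter> {2 * k..<n})) = card (U \<inter> {..<2 * k}) + card (U \<inter> {2 * k..<n})"
    by (intro card_Un_disjoint) auto
  moreover have "(U \<inter> {..<2 * k}) \<union> (U \<inter> {2 * k..<n}) = U" using assms(2) by auto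
  ultimately show ?thesis by (simp add: card_transversal[OF assms(1)])
qed

text \<open>Exchanging the coordinates \<open>2 * l\<close> and \<open>2 * l + 1\<close> of a pair that \<open>U\<close> does not separate
  permutes the supersets of \<open>U\<close> and reverses the sign.\<close>

lemma sum_pair_sign_supersets_not_transversal:
  assumes "2 * k \<le> n" "\<not> transversal k U"
  shows "(\<Sum>A | U \<subseteq> A \<and> A \<subseteq> {..<n} \<and> card A = i. pair_sign k A) = 0"
proof -
  obtain l where l: "l < k" "2 * l \<in> U \<longleftrightarrow> Suc (2 * l) \<in> U"
    using assms(2) by (auto simp: transversal_def)
  define \<tau> where "\<tau> = Transposition.transpose (2 * l) (Suc (2 * l))"
  have inv: "\<tau> (\<tau> x) = x" for x by (simp add: \<tau>_def)
  have mem: "x \<in> \<tau> ` A \<longleftrightarrow> \<tau> x \<in> A" for x A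
    by (metis image_iff inv)
  have tau_n: "\<tau> x < n \<longleftrightarrow> x < n" for x
    using l(1) assms(1) by (auto simp: \<tau>_def Transposition.transpose_def)
  have tau_U: "\<tau> x \<in> U \<longleftrightarrow> x \<in> U" for x
    using l(2) by (auto simp: \<tau>_def Transposition.transpose_def)
  have sgn: "pair_sign k (\<tau> ` A) = - pair_sign k A" for A
  proof -
    have "(\<Prod>m\<in>{..<k} - {l}. of_bool (2 * m \<in> \<tau> ` A) - of_bool (Suc (2 * m) \<in> \<tau> ` A))
        = (\<Prod>m\<in>{..<k} - {l}. of_bool (2 * m \<in> A) - of_bool (Suc (2 * m) \<in> A) :: real)"
    proof (rule prod.cong[OF refl])
      fix m assume "m \<in> {..<k} - {l}"
      then have "\<tau> (2 * m) = 2 * m" "\<tau> (Suc (2 * m)) = Suc (2 * m)"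
        by (auto simp: \<tau>_def Transposition.transpose_def)
      then show "of_bool (2 * m \<in> \<tau> ` A) - of_bool (Suc (2 * m) \<in> \<tau> ` A)
          = (of_bool (2 * m \<in> A) - of_bool (Suc (2 * m) \<in> A) :: real)"
        by (simp add: mem)
    qed
    moreover have "\<tau> (2 * l) = Suc (2 * l)" "\<tau> (Suc (2 * l)) = 2 * l" by (auto simp: \<tau>_def)
    ultimately show ?thesis
      unfolding pair_sign_def using l(1)
      by (simp add: prod.remove[of "{..<k}" l] mem algebra_simps)
  qed
  let ?S = "{A. U \<subseteq> A \<and> A \<subseteq> {..<n} \<and> card A = i}"
  have maps: "\<tau> ` A \<in> ?S" if "A \<in> ?S" for A
  proof -
    have "inj \<tau>" by (metis inv injI)
    then have "card (\<tau> ` A) = card A" by (intro card_image) (auto simp: inj_on_def)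
    with that show ?thesis by (auto simp: mem tau_n) (metis mem tau_U subsetD)
  qed
  have "sum (pair_sign k) ?S = (\<Sum>A\<in>?S. - pair_sign k A)"
    by (rule sum.reindex_bij_witness[where i = "image \<tau>" and j = "image \<tau>"])
      (use maps in \<open>auto simp: image_image inv sgn\<close>)
  then show ?thesis by (simp add: sum_negf)
qed

text \<open>Every superset that contributes has the sign of \<open>U\<close>, so the sum counts ways
  to add \<open>i - card U\<close> points. They come from the coordinates from \<open>2 * k\<close>
  on that are not in \<open>U\<close>; as \<open>U\<close> has \<open>card U - k\<close> points
  there, \<open>n - k - card U\<close> are free. This is the origin of the last two binomials of
  \<open>beta_coeff\<close>.\<close>

lemma sum_pair_sign_supersets_transversal:
  assumes k: "2 * k \<le> n" and tr: "transversal k U" and U: "U \<subseteq> {..<n}"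
  shows "(\<Sum>A | U \<subseteq> A \<and> A \<subseteq> {..<n} \<and> card A = i. pair_sign k A)
    = pair_sign k U * ibinom (int n - int k - int (card U)) (int i - int (card U))"
proof -
  let ?S = "{A. U \<subseteq> A \<and> A \<subseteq> {..<n} \<and> card A = i}"
  let ?T = "{A \<in> ?S. transversal k A}"
  let ?R = "{2 * k..<n} - U"
  have fin: "finite ?S" by (rule finite_subset[of _ "Pow {..<n}"]) auto
  have finU: "finite U" using U finite_subset by blast
  have "sum (pair_sign k) ?S = sum (pair_sign k) ?T"
    using fin by (intro sum.mono_neutral_right) (auto simp: pair_sign_eq_0_iff)
  also have "\<dots> = (\<Sum>A\<in>?T. pair_sign k U)"
    by (intro sum.cong refl pair_sign_cong transversal_subset_eq) (use tr in auto)
  also have "\<dots> = pair_sign k U * real (card ?T)" by simp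
  also have "real (card ?T) = ibinom (int n - int k - int (card U)) (int i - int (card U))"
  proof -
    note cU = card_transversal_split[OF tr U]
    have cR: "card ?R = (n - 2 * k) - card (U \<inter> {2 * k..<n})"
      by (simp add: card_Diff_subset_Int Int_commute)
    have le: "card (U \<inter> {2 * k..<n}) \<le> n - 2 * k"
      by (rule order.trans[OF card_mono[of "{2 * k..<n}"]]) auto
    have R: "int (card ?R) = int n - int k - int (card U)"
      using cU cR le k by simp
    show ?thesis
    proof (cases "card U \<le> i")
      case False
      have "card U \<le> card A" if "U \<subseteq> A" "A \<subseteq> {..<n}" for A
        using that by (meson card_mono finite_lessThan finite_subset)
      with False have "?T = {}" by auto
      with False show ?thesis by (simp only: ibinom_def) auto
    next
      case True
      have "bij_betw (\<lambda>B. U \<union> B) {B. B \<subseteq> ?R \<and> card B = i - card U} ?T"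
      proof (rule bij_betw_byWitness[where f' = "\<lambda>A. A - U"])
        show "(\<lambda>B. U \<union> B) ` {B. B \<subseteq> ?R \<and> card B = i - card U} \<subseteq> ?T"
        proof safe
          fix B assume B: "B \<subseteq> ?R" "card B = i - card U"
          then have "finite B" by (meson finite_Diff finite_atLeastLessThan finite_subset)
          then show "card (U \<union> B) = i"
            using B True finU by (subst card_Un_disjoint) auto
          have "(U \<union> B) \<inter> {..<2 * k} = U \<inter> {..<2 * k}" using B by auto
          from transversal_cong[OF this] show "transversal k (U \<union> B)" using tr by simp
        qed (use U in auto)
        show "(\<lambda>A. A - U) ` ?T \<subseteq> {B. B \<subseteq> ?R \<and> card B = i - card U}"
        proof safe
          fix A x assume A: "U \<subseteq> A" "A \<subseteq> {..<n}" "transversal k A"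
          show "card (A - U) = card A - card U"
            using A finU by (simp add: card_Diff_subset)
          assume "x \<in> A" "x \<notin> U"
          with transversal_subset_eq[OF A(3) tr A(1)] A(2) show "x \<in> {2 * k..<n}"
          by (metis IntD1 IntI atLeastLessThan_iff lessThan_iff not_le subsetD)
        qed
      qed auto
      then have "card ?T = card {B. B \<subseteq> ?R \<and> card B = i - card U}"
        by (simp add: bij_betw_same_card)
      also have "\<dots> = card ?R choose (i - card U)" by (simp add: n_subsets)
      also have "real \<dots> = ibinom (int (card ?R)) (int i - int (card U))"
        using True by (auto simp: ibinom_def nat_diff_distrib)
      finally show ?thesis unfolding R .
    qed
  qed
  finally show ?thesis .
qed

text \<open>A transversal is chosen freely below \<open>2 * k\<close>, where it has \<open>k\<close>
  points, and its other \<open>u - k\<close> points are arbitrary among the remaining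
  \<open>n - 2 * k\<close> coordinates. This is the origin of the middle binomial of
  \<open>beta_coeff\<close>.\<close>

lemma card_transversals:
  assumes k: "2 * k \<le> n"
  shows "real (card {U. U \<subseteq> {..<n} \<and> card U = u \<and> transversal k U})
    = real (card {U. U \<subseteq> {..<2 * k} \<and> transversal k U}) * ibinom (int n - 2 * int k) (int u - int k)"
    (is "real (card ?A) = real (card ?G) * _")
proof (cases "k \<le> u")
  case False
  have "k \<le> card U" if "U \<subseteq> {..<n}" "transversal k U" for U
    using card_transversal[OF that(2)] card_mono[of U "U \<inter> {..<2 * k}"]
      finite_subset[OF that(1)] by auto
  with False have "?A = {}" by auto
  with False show ?thesis by (simp only: ibinom_def) auto
next
  case True
  let ?B = "{B. B \<subseteq> {2 * k..<n} \<and> card B = u - k}"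
  have "bij_betw (\<lambda>(S, B). S \<union> B) (?G \<times> ?B) ?A"
  proof (rule bij_betw_byWitness[where f' = "\<lambda>U. (U \<inter> {..<2 * k}, U \<inter> {2 * k..<n})"])
    show "\<forall>a\<in>?G \<times> ?B. (\<lambda>U. (U \<inter> {..<2 * k}, U \<inter> {2 * k..<n})) ((\<lambda>(S, B). S \<union> B) a) = a"
      by fastforce
    show "\<forall>U\<in>?A. (\<lambda>(S, B). S \<union> B) (U \<inter> {..<2 * k}, U \<inter> {2 * k..<n}) = U"
      by auto
    show "(\<lambda>(S, B). S \<union> B) ` (?G \<times> ?B) \<subseteq> ?A"
    proof safe
      fix S B x assume *: "S \<subseteq> {..<2 * k}" "transversal k S" "B \<subseteq> {2 * k..<n}" "card B = u - k"
      then have "finite S" "finite B" "S \<inter> B = {}" using finite_subset by fastforce+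
      moreover have "card S = k" using card_transversal[OF *(2)] *(1) by (simp add: Int_absorb2)
      ultimately show "card (S \<union> B) = u" using * True by (subst card_Un_disjoint) auto
      have "(S \<union> B) \<inter> {..<2 * k} = S \<inter> {..<2 * k}" using * by auto
      from transversal_cong[OF this] show "transversal k (S \<union> B)" using * by simp
    qed (use k in \<open>fastforce\<close>)+
    show "(\<lambda>U. (U \<inter> {..<2 * k}, U \<inter> {2 * k..<n})) ` ?A \<subseteq> ?G \<times> ?B"
    proof safe
      fix U assume U: "U \<subseteq> {..<n}" "transversal k U" "u = card U"
      show "transversal k (U \<inter> {..<2 * k})"
        using U(2) transversal_cong[of U k "U \<inter> {..<2 * k}"] by simp
      show "card (U \<inter> {2 * k..<n}) = card U - k"
        using card_transversal_split[OF U(2,1)] by simp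
    qed
  qed
  then have "card ?A = card ?G * card ?B"
    using bij_betw_same_card by (fastforce simp: card_cartesian_product)
  also have "card ?B = (n - 2 * k) choose (u - k)" by (simp add: n_subsets)
  finally have "real (card ?A) = real (card ?G) * real ((n - 2 * k) choose (u - k))" by simp
  also have "real ((n - 2 * k) choose (u - k)) = ibinom (int n - 2 * int k) (int u - int k)"
  proof -
    have "nat (int n - 2 * int k) = n - 2 * k" "nat (int u - int k) = u - k" by simp_all
    with True k show ?thesis by (auto simp: ibinom_def)
  qed
  finally show ?thesis .
qed

text \<open>The count is \<open>2 ^ k\<close>; being positive, it can be cancelled from the sign
  condition on a quadratic form.\<close>

lemma transversals_nonempty: "card {U. U \<subseteq> {..<2 * k} \<and> transversal k U} > 0"
proof -
  have "(*) 2 ` {..<k} \<in> {U. U \<subseteq> {..<2 * k} \<and> transversal k U}"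
    by (auto simp: transversal_def) presburger
  then show ?thesis
    by (subst card_gt_0_iff) (auto intro: finite_subset[of _ "Pow {..<2 * k}"])
qed

text \<open>Binomial inversion writes the condition \<open>card (A \<inter> B) = t\<close> as a signed count of the subsets
  \<open>U\<close> of \<open>A \<inter> B\<close>; for fixed \<open>U\<close> the sums over \<open>A\<close> and \<open>B\<close> are independent.\<close>

lemma beta_coeff_pair_sign:
  assumes k: "2 * k \<le> n"
  shows "(\<Sum>A | A \<subseteq> {..<n} \<and> card A = i. \<Sum>B | B \<subseteq> {..<n} \<and> card B = j.
      of_bool (card (A \<inter> B) = t) * (pair_sign k A * pair_sign k B))
    = real (card {U. U \<subseteq> {..<2 * k} \<and> transversal k U}) * beta_coeff n i j k t"
proof -
  let ?P = "\<lambda>i. {A. A \<subseteq> {..<n} \<and> card A = i}"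
  define N where "N = real (card {U. U \<subseteq> {..<2 * k} \<and> transversal k U})"
  define c where "c u = (-1) powi (int t - int u) * real (u choose t)" for u
  define h where "h i U = (\<Sum>A | U \<subseteq> A \<and> A \<subseteq> {..<n} \<and> card A = i. pair_sign k A)" for i U
  have fin: "finite (?P i)" for i by (rule finite_subset[of _ "Pow {..<n}"]) auto
  have delta: "of_bool (card (A \<inter> B) = t)
      = (\<Sum>u=0..n. \<Sum>U\<in>?P u. c u * of_bool (U \<subseteq> A) * of_bool (U \<subseteq> B))"
    if "A \<subseteq> {..<n}" for A B
  proof -
    have fAB: "finite (A \<inter> B)" using that finite_subset by blast
    have le: "card (A \<inter> B) \<le> n"
      using card_mono[of "{..<n}" "A \<inter> B"] that by auto
    have "(\<Sum>U\<in>?P u. c u * of_bool (U \<subseteq> A) * of_bool (U \<subseteq> B))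
        = c u * real (card (A \<inter> B) choose u)" for u
    proof -
      have "(\<Sum>U\<in>?P u. c u * of_bool (U \<subseteq> A) * of_bool (U \<subseteq> B))
          = (\<Sum>U\<in>?P u. if U \<subseteq> A \<inter> B then c u else 0)"
        by (intro sum.cong) auto
      also have "\<dots> = (\<Sum>U | U \<in> ?P u \<and> U \<subseteq> A \<inter> B. c u)"
        by (subst sum.inter_filter[symmetric]) (use fin in auto)
      also have "{U. U \<in> ?P u \<and> U \<subseteq> A \<inter> B} = {U. U \<subseteq> A \<inter> B \<and> card U = u}"
        using that by auto
      finally show ?thesis by (simp only: sum_constant n_subsets[OF fAB] mult.commute)
    qed
    with binomial_inversion_delta[OF le, of t] show ?thesis
      by (simp add: c_def eq_commute)
  qed
  have h: "h i U = (\<Sum>A\<in>?P i. of_bool (U \<subseteq> A) * pair_sign k A)" for i U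
  proof -
    have "(\<Sum>A\<in>?P i. of_bool (U \<subseteq> A) * pair_sign k A)
        = (\<Sum>A\<in>?P i. if U \<subseteq> A then pair_sign k A else 0)"
      by (intro sum.cong) auto
    also have "\<dots> = (\<Sum>A | A \<in> ?P i \<and> U \<subseteq> A. pair_sign k A)"
      by (subst sum.inter_filter[symmetric]) (use fin in auto)
    finally show ?thesis unfolding h_def by (simp add: conj_ac)
  qed
  have "(\<Sum>A\<in>?P i. \<Sum>B\<in>?P j. of_bool (card (A \<inter> B) = t) * (pair_sign k A * pair_sign k B))
      = (\<Sum>A\<in>?P i. \<Sum>B\<in>?P j. \<Sum>u=0..n. \<Sum>U\<in>?P u.
          c u * ((of_bool (U \<subseteq> A) * pair_sign k A) * (of_bool (U \<subseteq> B) * pair_sign k B)))"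
    by (intro sum.cong refl) (simp add: delta sum_distrib_right sum_distrib_left mult_ac)
  also have "\<dots> = (\<Sum>u=0..n. \<Sum>A\<in>?P i. \<Sum>B\<in>?P j. \<Sum>U\<in>?P u.
          c u * ((of_bool (U \<subseteq> A) * pair_sign k A) * (of_bool (U \<subseteq> B) * pair_sign k B)))"
    by (simp only: sum.swap[of _ "?P j" "{0..n}"] sum.swap[of _ "?P i" "{0..n}"])
  also have "\<dots> = (\<Sum>u=0..n. \<Sum>U\<in>?P u. \<Sum>A\<in>?P i. \<Sum>B\<in>?P j.
          c u * ((of_bool (U \<subseteq> A) * pair_sign k A) * (of_bool (U \<subseteq> B) * pair_sign k B)))"
  proof (rule sum.cong[OF refl])
    fix u
    let ?f = "\<lambda>A B U. c u * ((of_bool (U \<subseteq> A) * pair_sign k A) * (of_bool (U \<subseteq> B) * pair_sign k B))"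
    have "(\<Sum>A\<in>?P i. \<Sum>B\<in>?P j. \<Sum>U\<in>?P u. ?f A B U) = (\<Sum>A\<in>?P i. \<Sum>U\<in>?P u. \<Sum>B\<in>?P j. ?f A B U)"
      by (rule sum.cong[OF refl]) (rule sum.swap)
    also have "\<dots> = (\<Sum>U\<in>?P u. \<Sum>A\<in>?P i. \<Sum>B\<in>?P j. ?f A B U)"
      by (rule sum.swap)
    finally show "(\<Sum>A\<in>?P i. \<Sum>B\<in>?P j. \<Sum>U\<in>?P u. ?f A B U) = (\<Sum>U\<in>?P u. \<Sum>A\<in>?P i. \<Sum>B\<in>?P j. ?f A B U)" .
  qed
  also have "\<dots> = (\<Sum>u=0..n. \<Sum>U\<in>?P u. c u * (h i U * h j U))"
    unfolding h sum_product by (simp only: sum_distrib_left)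
  also have "\<dots> = (\<Sum>u=0..n. c u * (N * ibinom (int n - 2 * int k) (int u - int k)
      * (ibinom (int n - int k - int u) (int i - int u) * ibinom (int n - int k - int u) (int j - int u))))"
  proof (rule sum.cong[OF refl])
    fix u
    let ?b = "ibinom (int n - int k - int u) (int i - int u) * ibinom (int n - int k - int u) (int j - int u)"
    \<comment> \<open>Sets \<open>U\<close> that are not transversal cancel in \<open>h\<close>. For
      a transversal \<open>U\<close> the two factors \<open>pair_sign k U\<close> multiply to 1, so
      what remains does not depend on \<open>U\<close> beyond its size.\<close>
    have "(\<Sum>U\<in>?P u. c u * (h i U * h j U)) = (\<Sum>U\<in>?P u. if transversal k U then c u * ?b else 0)"
    proof (rule sum.cong[OF refl])
      fix U assume U: "U \<in> ?P u"
      show "c u * (h i U * h j U) = (if transversal k U then c u * ?b else 0)"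
      proof (cases "transversal k U")
        case True
        with U pair_sign_square[OF True] show ?thesis
          by (simp add: h_def sum_pair_sign_supersets_transversal[OF k True])
      next
        case False
        then show ?thesis by (simp add: h_def sum_pair_sign_supersets_not_transversal[OF k False])
      qed
    qed
    also have "\<dots> = (\<Sum>U | U \<in> ?P u \<and> transversal k U. c u * ?b)"
      by (subst sum.inter_filter[symmetric]) (use fin in auto)
    also have "\<dots> = real (card {U. U \<subseteq> {..<n} \<and> card U = u \<and> transversal k U}) * (c u * ?b)"
      by (simp add: conj_assoc)
    finally show "(\<Sum>U\<in>?P u. c u * (h i U * h j U))
        = c u * (N * ibinom (int n - 2 * int k) (int u - int k) * ?b)"
      by (simp add: card_transversals[OF k] N_def)
  qed
  also have "\<dots> = N * beta_coeff n i j k t"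
  proof -
    have "ibinom (int u) (int t) = real (u choose t)" for u
      by (simp add: ibinom_def)
    then show ?thesis
      by (simp add: beta_coeff_def c_def sum_distrib_left mult_ac)
  qed
  finally show ?thesis unfolding N_def .
qed

section \<open>Positive semidefinite blocks\<close>

text \<open>Inserting the signed count for \<open>beta_coeff\<close> and exchanging the sums leaves,
  for each pair \<open>A\<close>, \<open>B\<close>, the single index
  \<open>t = card (A \<inter> B)\<close>, which does belong to the range of summation.\<close>

lemma transversals_block:
  assumes "2 * k \<le> n"
  shows "real (card {U. U \<subseteq> {..<2 * k} \<and> transversal k U}) * block n x k i j
    = (\<Sum>A | A \<subseteq> {..<n} \<and> card A = i. \<Sum>B | B \<subseteq> {..<n} \<and> card B = j.
        pair_sign k A * pair_sign k B * x i j (card (A \<inter> B)))"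
proof -
  let ?P = "\<lambda>i. {A. A \<subseteq> {..<n} \<and> card A = i}" and ?T = "{t. (i, j, t) \<in> I2 n}"
  have finT: "finite ?T" by (rule finite_subset[of _ "{..n}"]) (auto simp: I2_def)
  have "real (card {U. U \<subseteq> {..<2 * k} \<and> transversal k U}) * block n x k i j
      = (\<Sum>t\<in>?T. (\<Sum>A\<in>?P i. \<Sum>B\<in>?P j. of_bool (card (A \<inter> B) = t) * (pair_sign k A * pair_sign k B)) * x i j t)"
    unfolding block_def beta_coeff_pair_sign[OF assms] by (simp add: sum_distrib_left mult_ac)
  also have "\<dots> = (\<Sum>t\<in>?T. \<Sum>A\<in>?P i. \<Sum>B\<in>?P j.
      (pair_sign k A * pair_sign k B) * (if t = card (A \<inter> B) then x i j t else 0))"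
    unfolding sum_distrib_right by (intro sum.cong refl) auto
  also have "\<dots> = (\<Sum>A\<in>?P i. \<Sum>t\<in>?T. \<Sum>B\<in>?P j.
      (pair_sign k A * pair_sign k B) * (if t = card (A \<inter> B) then x i j t else 0))"
    by (rule sum.swap)
  also have "\<dots> = (\<Sum>A\<in>?P i. \<Sum>B\<in>?P j. \<Sum>t\<in>?T.
      (pair_sign k A * pair_sign k B) * (if t = card (A \<inter> B) then x i j t else 0))"
    by (rule sum.cong[OF refl]) (rule sum.swap)
  also have "\<dots> = (\<Sum>A\<in>?P i. \<Sum>B\<in>?P j. pair_sign k A * pair_sign k B * x i j (card (A \<inter> B)))"
  proof (intro sum.cong refl)
    fix A B assume AB: "A \<in> ?P i" "B \<in> ?P j"
    then have "card (A \<inter> B) \<in> ?T"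
      using dbar_in_I2[of n "word_of A" "word_of B"] by (simp add: dbar_word_of)
    then show "(\<Sum>t\<in>?T. (pair_sign k A * pair_sign k B) * (if t = card (A \<inter> B) then x i j t else 0))
        = pair_sign k A * pair_sign k B * x i j (card (A \<inter> B))"
      unfolding sum_distrib_left[symmetric] using finT by simp
  qed
  finally show ?thesis .
qed

definition sign_vector :: "nat \<Rightarrow> nat \<Rightarrow> (nat \<Rightarrow> real) \<Rightarrow> nat set \<Rightarrow> real" where
  "sign_vector n k v A = of_bool (card A \<in> {k..n - k}) * v (card A) * pair_sign k A"

lemma sum_by_card:
  fixes n k :: nat and f :: "nat set \<Rightarrow> real"
  shows "(\<Sum>i\<in>{k..n - k}. \<Sum>A | A \<subseteq> {..<n} \<and> card A = i. f A)
    = (\<Sum>A\<in>Pow {..<n}. of_bool (card A \<in> {k..n - k}) * f A)"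
proof -
  have "(\<Sum>i\<in>{k..n - k}. \<Sum>A | A \<in> {A. A \<subseteq> {..<n} \<and> card A \<in> {k..n - k}} \<and> card A = i. f A)
      = (\<Sum>A | A \<subseteq> {..<n} \<and> card A \<in> {k..n - k}. f A)"
    by (rule sum.group) (auto intro: finite_subset[of _ "Pow {..<n}"])
  also have "\<dots> = (\<Sum>A\<in>Pow {..<n}. of_bool (card A \<in> {k..n - k}) * f A)"
    by (rule sum.mono_neutral_cong_left) auto
  finally show ?thesis
    by (simp add: conj_ac cong: conj_cong)
qed

text \<open>Weighting \<open>transversals_block\<close> by \<open>v i * v j\<close> merges the
  weight classes into all pairs of sets. The right-hand side is the quadratic form of the full
  matrix at \<open>sign_vector\<close>, so positivity passes from that matrix to the block.\<close>

lemma block_quadratic_form: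
  assumes "2 * k \<le> n"
  shows "real (card {U. U \<subseteq> {..<2 * k} \<and> transversal k U})
      * (\<Sum>i\<in>{k..n - k}. \<Sum>j\<in>{k..n - k}. v i * block n x k i j * v j)
    = (\<Sum>A\<in>Pow {..<n}. \<Sum>B\<in>Pow {..<n}.
        sign_vector n k v A * sign_vector n k v B * x (card A) (card B) (card (A \<inter> B)))"
proof -
  let ?P = "\<lambda>i. {A. A \<subseteq> {..<n} \<and> card A = i}"
  let ?F = "\<lambda>A B. v (card A) * v (card B) * (pair_sign k A * pair_sign k B * x (card A) (card B) (card (A \<inter> B)))"
  define N where "N = real (card {U. U \<subseteq> {..<2 * k} \<and> transversal k U})"
  have "N * (\<Sum>i\<in>{k..n - k}. \<Sum>j\<in>{k..n - k}. v i * block n x k i j * v j)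
      = (\<Sum>i\<in>{k..n - k}. \<Sum>j\<in>{k..n - k}. v i * v j * (N * block n x k i j))"
    by (simp add: sum_distrib_left mult_ac)
  also have "\<dots> = (\<Sum>i\<in>{k..n - k}. \<Sum>j\<in>{k..n - k}. \<Sum>A\<in>?P i. \<Sum>B\<in>?P j. ?F A B)"
    unfolding N_def transversals_block[OF assms] sum_distrib_left by (intro sum.cong refl) auto
  also have "\<dots> = (\<Sum>i\<in>{k..n - k}. \<Sum>A\<in>?P i. \<Sum>j\<in>{k..n - k}. \<Sum>B\<in>?P j. ?F A B)"
    by (rule sum.cong[OF refl]) (rule sum.swap)
  also have "\<dots> = (\<Sum>A\<in>Pow {..<n}. \<Sum>B\<in>Pow {..<n}.
        sign_vector n k v A * sign_vector n k v B * x (card A) (card B) (card (A \<inter> B)))"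
    unfolding sum_by_card by (simp add: sum_distrib_left sign_vector_def mult_ac)
  finally show ?thesis unfolding N_def .
qed

lemma block_symmetric:
  assumes "\<And>t. (i, j, t) \<in> I2 n \<Longrightarrow> x i j t = x j i t"
  shows "block n x k i j = block n x k j i"
  unfolding block_def
proof (rule sum.cong)
  show "{t. (i, j, t) \<in> I2 n} = {t. (j, i, t) \<in> I2 n}" by (auto simp: I2_def)
  show "beta_coeff n i j k t * x i j t = beta_coeff n j i k t * x j i t" if "t \<in> {t. (j, i, t) \<in> I2 n}" for t
  proof -
    have "x i j t = x j i t" using that by (intro assms) (auto simp: I2_def)
    then show ?thesis by (simp add: beta_coeff_def mult_ac)
  qed
qed

text \<open>One notion for all the matrices in (B) and (C): the weight \<open>p\<close> absorbs both
  the probability and the variable \<open>q\<close>, so it is nonnegative but not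
  normalized.\<close>

definition gram_family :: "nat \<Rightarrow> 'w set \<Rightarrow> ('w \<Rightarrow> real) \<Rightarrow> ('w \<Rightarrow> (nat \<Rightarrow> bit) \<Rightarrow> real)
    \<Rightarrow> (nat \<Rightarrow> nat \<Rightarrow> nat \<Rightarrow> real) \<Rightarrow> bool" where
  "gram_family n \<Omega> p \<phi> x \<longleftrightarrow> (\<forall>\<omega>\<in>\<Omega>. 0 \<le> p \<omega>) \<and>
     (\<forall>u\<in>words n. \<forall>v\<in>words n. \<forall>i j t. dbar n u v = (i, j, t) \<longrightarrow>
        x i j t = (\<Sum>\<omega>\<in>\<Omega>. p \<omega> * \<phi> \<omega> u * \<phi> \<omega> v))"

lemma gram_family_quadratic_form:
  assumes x: "gram_family n \<Omega> p \<phi> x" and k: "2 * k \<le> n"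
  shows "real (card {U. U \<subseteq> {..<2 * k} \<and> transversal k U})
      * (\<Sum>i\<in>{k..n - k}. \<Sum>j\<in>{k..n - k}. v i * block n x k i j * v j)
    = (\<Sum>\<omega>\<in>\<Omega>. p \<omega> * (\<Sum>A\<in>Pow {..<n}. sign_vector n k v A * \<phi> \<omega> (word_of A))\<^sup>2)"
proof -
  let ?s = "sign_vector n k v"
  have "(\<Sum>A\<in>Pow {..<n}. \<Sum>B\<in>Pow {..<n}. ?s A * ?s B * x (card A) (card B) (card (A \<inter> B)))
      = (\<Sum>A\<in>Pow {..<n}. \<Sum>B\<in>Pow {..<n}. \<Sum>\<omega>\<in>\<Omega>.
          p \<omega> * ((?s A * \<phi> \<omega> (word_of A)) * (?s B * \<phi> \<omega> (word_of B))))"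
  proof (intro sum.cong refl)
    fix A B assume "A \<in> Pow {..<n}" "B \<in> Pow {..<n}"
    then have "x (card A) (card B) (card (A \<inter> B)) = (\<Sum>\<omega>\<in>\<Omega>. p \<omega> * \<phi> \<omega> (word_of A) * \<phi> \<omega> (word_of B))"
      using x by (simp add: gram_family_def word_of_in_words dbar_word_of)
    then show "?s A * ?s B * x (card A) (card B) (card (A \<inter> B))
        = (\<Sum>\<omega>\<in>\<Omega>. p \<omega> * ((?s A * \<phi> \<omega> (word_of A)) * (?s B * \<phi> \<omega> (word_of B))))"
      by (simp add: sum_distrib_left mult_ac)
  qed
  also have "\<dots> = (\<Sum>A\<in>Pow {..<n}. \<Sum>\<omega>\<in>\<Omega>. \<Sum>B\<in>Pow {..<n}.
          p \<omega> * ((?s A * \<phi> \<omega> (word_of A)) * (?s B * \<phi> \<omega> (word_of B))))"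
    by (rule sum.cong[OF refl]) (rule sum.swap)
  also have "\<dots> = (\<Sum>\<omega>\<in>\<Omega>. \<Sum>A\<in>Pow {..<n}. \<Sum>B\<in>Pow {..<n}.
          p \<omega> * ((?s A * \<phi> \<omega> (word_of A)) * (?s B * \<phi> \<omega> (word_of B))))"
    by (rule sum.swap)
  also have "\<dots> = (\<Sum>\<omega>\<in>\<Omega>. p \<omega> * (\<Sum>A\<in>Pow {..<n}. ?s A * \<phi> \<omega> (word_of A))\<^sup>2)"
    unfolding power2_eq_square sum_product by (simp only: sum_distrib_left)
  finally show ?thesis
    unfolding block_quadratic_form[OF k] .
qed

lemma gram_family_block_symmetric:
  assumes "gram_family n \<Omega> p \<phi> x"
  shows "block n x k i j = block n x k j i"
proof (rule block_symmetric)
  fix t assume "(i, j, t) \<in> I2 n"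
  then obtain u v where "u \<in> words n" "v \<in> words n" "dbar n u v = (i, j, t)"
    by (rule I2_dbar_witness)
  moreover from this have "dbar n v u = (j, i, t)" by (simp add: dbar_swap)
  ultimately show "x i j t = x j i t"
    using assms by (simp add: gram_family_def mult_ac)
qed

lemma gram_family_psd_on:
  assumes x: "gram_family n \<Omega> p \<phi> x" and k: "2 * k \<le> n"
  shows "psd_on {k..n - k} (block n x k)"
  unfolding psd_on_def
proof (intro conjI ballI allI)
  fix v
  define N where "N = real (card {U. U \<subseteq> {..<2 * k} \<and> transversal k U})"
  have "N > 0" using transversals_nonempty by (simp add: N_def)
  moreover have "0 \<le> N * (\<Sum>i\<in>{k..n - k}. \<Sum>j\<in>{k..n - k}. v i * block n x k i j * v j)"
    unfolding N_def gram_family_quadratic_form[OF assms]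
    using x by (intro sum_nonneg mult_nonneg_nonneg) (auto simp: gram_family_def)
  ultimately show "0 \<le> (\<Sum>i\<in>{k..n - k}. \<Sum>j\<in>{k..n - k}. v i * block n x k i j * v j)"
    by (simp add: zero_le_mult_iff)
qed (rule gram_family_block_symmetric[OF x])

lemma bordered_quadratic_form:
  assumes "finite S"
  shows "(\<Sum>p\<in>insert None (Some ` S). \<Sum>q\<in>insert None (Some ` S). v p * bordered c y L p q * v q)
    = c * (v None)\<^sup>2 + 2 * v None * (\<Sum>i\<in>S. y i * v (Some i))
      + (\<Sum>i\<in>S. \<Sum>j\<in>S. v (Some i) * L i j * v (Some j))"
proof -
  have s: "(\<Sum>q\<in>insert None (Some ` S). f q) = f None + (\<Sum>i\<in>S. f (Some i))" for f :: "'a option \<Rightarrow> real"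
    using assms by (subst sum.insert) (auto simp: sum.reindex)
  show ?thesis
    unfolding s bordered_def
    by (simp add: sum.distrib sum_distrib_left power2_eq_square mult_ac)
qed

text \<open>For \<open>k = 0\<close> the compressing vectors are the indicators of the weight
  classes. The bordered form is then the weighted sum of the squares
  \<open>(v None + F \<omega>)^2\<close>, where \<open>F\<close> is linear in \<open>\<phi>\<close>.
  The factor \<open>n choose i\<close> in the border is the size of the \<open>i\<close>-th
  class.\<close>

lemma gram_family_psd_bordered_on:
  assumes x: "gram_family n \<Omega> p \<phi> x" and c: "c = (\<Sum>\<omega>\<in>\<Omega>. p \<omega>)"
    and y: "\<And>i. i \<le> n \<Longrightarrow> y i = real (n choose i) * y' i"
    and y': "\<And>u. u \<in> words n \<Longrightarrow> y' (weight n u) = (\<Sum>\<omega>\<in>\<Omega>. p \<omega> * \<phi> \<omega> u)"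
  shows "psd_bordered_on {0..n} c y (block n x 0)"
  unfolding psd_bordered_on_def psd_on_def
proof (intro conjI ballI allI)
  show "bordered c y (block n x 0) i j = bordered c y (block n x 0) j i" for i j
    using gram_family_block_symmetric[OF x] by (cases i; cases j) (auto simp: bordered_def)
  fix v :: "nat option \<Rightarrow> real"
  define w where "w i = v (Some i)" for i
  define F where "F \<omega> = (\<Sum>A\<in>Pow {..<n}. sign_vector n 0 w A * \<phi> \<omega> (word_of A))" for \<omega>
  have sv: "sign_vector n 0 w A = w (card A)" if "A \<subseteq> {..<n}" for A
    using card_mono[OF finite_lessThan that] by (simp add: sign_vector_def pair_sign_def)
  \<comment> \<open>The factor in the quadratic form must be exactly 1 here, because corner and
    border are not rescaled with the block.\<close>
  have "{U. U \<subseteq> {..<2 * 0} \<and> transversal 0 U} = {{}}" by (auto simp: transversal_def)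
  then have quad: "(\<Sum>i\<in>{0..n}. \<Sum>j\<in>{0..n}. w i * block n x 0 i j * w j) = (\<Sum>\<omega>\<in>\<Omega>. p \<omega> * (F \<omega>)\<^sup>2)"
    using gram_family_quadratic_form[OF x, of 0 w] by (simp add: F_def)
  have "(\<Sum>i\<in>{0..n}. y i * w i) = (\<Sum>i\<in>{0..n}. \<Sum>A | A \<subseteq> {..<n} \<and> card A = i. y' (card A) * w (card A))"
    by (simp add: y n_subsets mult.assoc)
  also have "\<dots> = (\<Sum>A\<in>Pow {..<n}. y' (card A) * w (card A))"
    using sum_by_card[where k = 0 and n = n and f = "\<lambda>A. y' (card A) * w (card A)"] card_mono[OF finite_lessThan, of _ n]
    by (auto intro!: sum.cong)
  also have "\<dots> = (\<Sum>A\<in>Pow {..<n}. \<Sum>\<omega>\<in>\<Omega>. p \<omega> * (sign_vector n 0 w A * \<phi> \<omega> (word_of A)))"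
  proof (rule sum.cong[OF refl])
    fix A assume A: "A \<in> Pow {..<n}"
    then have "weight n (word_of A) = card A"
      using dbar_weight[OF dbar_word_of] by blast
    with A y'[of "word_of A"] have "y' (card A) = (\<Sum>\<omega>\<in>\<Omega>. p \<omega> * \<phi> \<omega> (word_of A))"
      by (simp add: word_of_in_words)
    with A show "y' (card A) * w (card A) = (\<Sum>\<omega>\<in>\<Omega>. p \<omega> * (sign_vector n 0 w A * \<phi> \<omega> (word_of A)))"
      by (simp add: sv sum_distrib_left mult_ac)
  qed
  also have "\<dots> = (\<Sum>\<omega>\<in>\<Omega>. p \<omega> * F \<omega>)"
    unfolding F_def sum_distrib_left by (rule sum.swap)
  finally have lin: "(\<Sum>i\<in>{0..n}. y i * w i) = (\<Sum>\<omega>\<in>\<Omega>. p \<omega> * F \<omega>)" .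
  have "(\<Sum>p\<in>insert None (Some ` {0..n}). \<Sum>q\<in>insert None (Some ` {0..n}). v p * bordered c y (block n x 0) p q * v q)
      = (\<Sum>\<omega>\<in>\<Omega>. p \<omega> * (v None + F \<omega>)\<^sup>2)"
    using quad lin unfolding bordered_quadratic_form[OF finite_atLeastAtMost] w_def c
    by (simp add: power2_sum distrib_left sum.distrib sum_distrib_left sum_distrib_right mult_ac)
  also have "\<dots> \<ge> 0"
    using x by (intro sum_nonneg mult_nonneg_nonneg) (auto simp: gram_family_def)
  finally show "0 \<le> (\<Sum>p\<in>insert None (Some ` {0..n}). \<Sum>q\<in>insert None (Some ` {0..n}).
      v p * bordered c y (block n x 0) p q * v q)" .
qed

section \<open>Existence of the minimum\<close>

lemma I2_base [simp]: "(i, j, t) \<in> I2 n \<Longrightarrow> (i + j - 2 * t, 0, 0) \<in> I2 n"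
  "(i, j, t) \<in> I2 n \<Longrightarrow> (i, 0, 0) \<in> I2 n"
  "(i, j, t) \<in> I2 n \<Longrightarrow> (j, 0, 0) \<in> I2 n"
  "(i, j, t) \<in> I2 n \<Longrightarrow> (i, i, i) \<in> I2 n"
  by (auto simp: I2_def)

lemma zero_I2 [simp]: "(0, 0, 0) \<in> I2 n"
  by (simp add: I2_def)

text \<open>Feasibility does not restrict the values off \<open>I2 n\<close>, so compactness is available only after
  truncating them to zero.\<close>

definition eq_on_I2 :: "nat \<Rightarrow> (nat \<Rightarrow> nat \<Rightarrow> nat \<Rightarrow> real) \<Rightarrow> (nat \<Rightarrow> nat \<Rightarrow> nat \<Rightarrow> real) \<Rightarrow> bool" where
  "eq_on_I2 n x y \<longleftrightarrow> (\<forall>(i, j, t)\<in>I2 n. x i j t = y i j t)"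

lemma eq_on_I2D: "eq_on_I2 n x y \<Longrightarrow> (i, j, t) \<in> I2 n \<Longrightarrow> x i j t = y i j t"
  by (auto simp: eq_on_I2_def)

lemma eq_on_I2I: "(\<And>i j t. (i, j, t) \<in> I2 n \<Longrightarrow> x i j t = y i j t) \<Longrightarrow> eq_on_I2 n x y"
  by (auto simp: eq_on_I2_def)

lemma block_eq_on_I2: "eq_on_I2 n x y \<Longrightarrow> block n x k = block n y k"
  unfolding block_def fun_eq_iff by (auto intro!: sum.cong dest: eq_on_I2D)

lemma compl_family_eq_on_I2: "eq_on_I2 n x y \<Longrightarrow> eq_on_I2 n (compl_family x) (compl_family y)"
  by (rule eq_on_I2I) (simp add: compl_family_def eq_on_I2D)

lemma z_family_eq_on_I2:
  assumes "eq_on_I2 n x y"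
  shows "eq_on_I2 n (z_family n lam \<beta> x) (z_family n lam \<beta> y)"
proof (rule eq_on_I2I)
  fix i j t assume "(i, j, t) \<in> I2 n"
  then have "x (i + j - 2 * t) 0 0 = y (i + j - 2 * t) 0 0"
    by (intro eq_on_I2D[OF assms]) simp
  then show "z_family n lam \<beta> x i j t = z_family n lam \<beta> y i j t"
    unfolding z_family_def
    by (auto intro!: sum.cong arg_cong2[where f = minus] simp: eq_on_I2D[OF assms])
qed

lemma psd_bordered_on_cong:
  "c = c' \<Longrightarrow> (\<And>i. i \<in> S \<Longrightarrow> y i = y' i) \<Longrightarrow> L = L' \<Longrightarrow> psd_bordered_on S c y L = psd_bordered_on S c' y' L'"
proof -
  assume *: "c = c'" "\<And>i. i \<in> S \<Longrightarrow> y i = y' i" "L = L'"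
  have "bordered c y L p q = bordered c' y' L' p q"
    if "p \<in> insert None (Some ` S)" "q \<in> insert None (Some ` S)" for p q
    using that * by (auto simp: bordered_def)
  then show ?thesis
    unfolding psd_bordered_on_def psd_on_def
    by (intro arg_cong2[where f = "(\<and>)"] ball_cong refl arg_cong[where f = All] ext arg_cong2[where f = "(\<le>)"] sum.cong) auto
qed

text \<open>All indices read by the constraints lie in \<open>I2 n\<close>: the quantified triples,
  the triples derived from them as in \<open>I2_base\<close>, and the ranges of the sums. Truncation
  therefore keeps feasibility.\<close>

lemma feasible_eq_on_I2:
  assumes xy: "eq_on_I2 n x y" and "feasible n lam \<beta> x"
  shows "feasible n lam \<beta> y"
proof -
  note e = eq_on_I2D[OF xy]
  have A: "constraint_A n y"
    unfolding constraint_A_def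
  proof clarify
    fix i j t assume ijt: "(i, j, t) \<in> I2 n"
    note A = assms(2)[unfolded feasible_def constraint_A_def, THEN conjunct1, rule_format, OF ijt, simplified]
    note es = e[OF ijt] e[OF I2_base(1)[OF ijt]] e[OF I2_base(2)[OF ijt]] e[OF I2_base(4)[OF ijt]] e[OF zero_I2]
    have "y i j t = y i' j' t'" if "(i', j', t') \<in> I2 n"
      "{#i, j, i + j - 2 * t#} = {#i', j', i' + j' - 2 * t'#}" for i' j' t'
      using A that e[OF that(1)] es(1) by fastforce
    then show "0 \<le> y i j t \<and> y i j t \<le> y i i i \<and> y i 0 0 + y (i + j - 2 * t) 0 0 - y 0 0 0 \<le> y i j t \<and>
        y i j t \<le> y (i + j - 2 * t) 0 0 \<and> (\<forall>(i', j', t')\<in>I2 n.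
           {#i, j, i + j - 2 * t#} = {#i', j', i' + j' - 2 * t'#} \<longrightarrow> y i j t = y i' j' t')"
      using A es by auto
  qed
  have i00: "(i, 0, 0) \<in> I2 n" "(i, i, i) \<in> I2 n" if "i \<in> {0..n}" for i using that by (auto simp: I2_def)
  have B: "constraint_B n y"
  proof -
    have "psd_bordered_on {0..n} (1 - x 0 0 0) (\<lambda>i. real (n choose i) * (x 0 0 0 - x i 0 0)) (block n (compl_family x) 0)
      = psd_bordered_on {0..n} (1 - y 0 0 0) (\<lambda>i. real (n choose i) * (y 0 0 0 - y i 0 0)) (block n (compl_family y) 0)"
      by (rule psd_bordered_on_cong)
        (use e[OF i00(1)] e[OF zero_I2] block_eq_on_I2[OF compl_family_eq_on_I2[OF xy]] in auto)
    then show ?thesis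
      using assms(2) block_eq_on_I2[OF compl_family_eq_on_I2[OF xy]] block_eq_on_I2[OF xy]
      by (simp add: feasible_def constraint_B_def)
  qed
  have C: "constraint_C n lam \<beta> y"
  proof -
    note z = z_family_eq_on_I2[OF xy, of lam \<beta>]
    have "psd_bordered_on {0..n} ((\<Sum>i=0..n. real (n choose i) * lam i * x 0 0 0) - \<beta>)
          (\<lambda>i. real (n choose i) * z_family n lam \<beta> x i i i) (block n (z_family n lam \<beta> x) 0)
      = psd_bordered_on {0..n} ((\<Sum>i=0..n. real (n choose i) * lam i * y 0 0 0) - \<beta>)
          (\<lambda>i. real (n choose i) * z_family n lam \<beta> y i i i) (block n (z_family n lam \<beta> y) 0)"
      by (rule psd_bordered_on_cong)
        (use eq_on_I2D[OF z i00(2)] e[OF zero_I2] block_eq_on_I2[OF z] in auto)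
    then show ?thesis
      using assms(2) block_eq_on_I2[OF z]
      by (simp add: feasible_def constraint_C_def Let_def)
  qed
  have "constraint_D n lam \<beta> y"
    unfolding constraint_D_def Let_def
  proof clarify
    fix i j t assume ijt: "(i, j, t) \<in> I2 n"
    note D = assms(2)[unfolded feasible_def constraint_D_def Let_def, THEN conjunct2, THEN conjunct2, THEN conjunct2,
        rule_format, OF ijt, simplified]
    have s: "sum f {(j', t'). (i, j', t') \<in> I2 n} = sum g {(j', t'). (i, j', t') \<in> I2 n}"
      if "\<And>j' t'. (i, j', t') \<in> I2 n \<Longrightarrow> f (j', t') = g (j', t')" for f g :: "nat \<times> nat \<Rightarrow> real"
      by (rule sum.cong) (use that in auto)
    have e': "x i 0 0 = y i 0 0" "x 0 0 0 = y 0 0 0" using e[OF zero_I2] e[OF I2_base(2)[OF ijt]] by auto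
    show "y i 0 0 * \<beta> \<le> (\<Sum>(j', t') | (i, j', t') \<in> I2 n. y i j' t' * lam_coeff n lam i j t j' t') \<and>
      (y 0 0 0 - y i 0 0) * \<beta>
          \<le> (\<Sum>(j', t') | (i, j', t') \<in> I2 n. (y j' 0 0 - y i j' t') * lam_coeff n lam i j t j' t') \<and>
      (y 0 0 0 - y i 0 0) * \<beta>
          \<le> (\<Sum>(j', t') | (i, j', t') \<in> I2 n.
              (y (i + j' - 2 * t') 0 0 - y i j' t') * lam_coeff n lam i j t j' t') \<and>
      (1 - 2 * y 0 0 0 + y i 0 0) * \<beta>
          \<le> (\<Sum>(j', t') | (i, j', t') \<in> I2 n.
              (y 0 0 0 - y j' 0 0 - y (i + j' - 2 * t') 0 0 + y i j' t') * lam_coeff n lam i j t j' t')"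
    proof (intro conjI)
      show "y i 0 0 * \<beta> \<le> (\<Sum>(j', t') | (i, j', t') \<in> I2 n. y i j' t' * lam_coeff n lam i j t j' t')"
        using D[THEN conjunct1] unfolding e' by (rule order_trans) (rule eq_refl, rule s, simp add: e)
      show "(y 0 0 0 - y i 0 0) * \<beta>
          \<le> (\<Sum>(j', t') | (i, j', t') \<in> I2 n. (y j' 0 0 - y i j' t') * lam_coeff n lam i j t j' t')"
        using D[THEN conjunct2, THEN conjunct1] unfolding e'
        by (rule order_trans) (rule eq_refl, rule s, simp add: e)
      show "(y 0 0 0 - y i 0 0) * \<beta>
          \<le> (\<Sum>(j', t') | (i, j', t') \<in> I2 n.
              (y (i + j' - 2 * t') 0 0 - y i j' t') * lam_coeff n lam i j t j' t')"
        using D[THEN conjunct2, THEN conjunct2, THEN conjunct1] unfolding e'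
        by (rule order_trans) (rule eq_refl, rule s, simp add: e)
      show "(1 - 2 * y 0 0 0 + y i 0 0) * \<beta>
          \<le> (\<Sum>(j', t') | (i, j', t') \<in> I2 n.
              (y 0 0 0 - y j' 0 0 - y (i + j' - 2 * t') 0 0 + y i j' t') * lam_coeff n lam i j t j' t')"
        using D[THEN conjunct2, THEN conjunct2, THEN conjunct2] unfolding e'
        by (rule order_trans) (rule eq_refl, rule s, simp add: e)
    qed
  qed
  with A B C show ?thesis by (simp add: feasible_def)
qed

lemma objective_eq_on_I2: "eq_on_I2 n x y \<Longrightarrow> objective n x = objective n y"
  unfolding objective_def by (auto intro!: sum.cong dest: eq_on_I2D)

section \<open>Closedness and boundedness of the feasible set\<close>

lemma continuous_coord [continuous_intros]:
  "continuous_on UNIV (\<lambda>x :: nat \<Rightarrow> nat \<Rightarrow> nat \<Rightarrow> real. x i j t)"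
proof -
  have "continuous_on UNIV (\<lambda>x :: nat \<Rightarrow> nat \<Rightarrow> nat \<Rightarrow> real. x i)" by simp
  from this[THEN continuous_on_product_then_coordinatewise, THEN continuous_on_product_then_coordinatewise]
  show ?thesis .
qed

lemma continuous_block:
  assumes "\<And>i j t. continuous_on UNIV (\<lambda>x. f x i j t)"
  shows "continuous_on UNIV (\<lambda>x :: nat \<Rightarrow> nat \<Rightarrow> nat \<Rightarrow> real. block n (f x) k i j)"
  unfolding block_def by (intro continuous_intros assms)

lemma continuous_compl_family [continuous_intros]:
  "continuous_on UNIV (\<lambda>x :: nat \<Rightarrow> nat \<Rightarrow> nat \<Rightarrow> real. compl_family x i j t)"
  unfolding compl_family_def by (intro continuous_intros)

lemma continuous_z_family [continuous_intros]:
  "continuous_on UNIV (\<lambda>x :: nat \<Rightarrow> nat \<Rightarrow> nat \<Rightarrow> real. z_family n lam \<beta> x i j t)"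
  unfolding z_family_def case_prod_beta by (intro continuous_intros)

lemma closed_Collect_psd_on:
  assumes "\<And>i j. continuous_on UNIV (\<lambda>x. A x i j)"
  shows "closed {x. psd_on S (A x)}"
  unfolding psd_on_def Ball_def
  by (intro closed_Collect_conj closed_Collect_all closed_Collect_imp open_Collect_const
      closed_Collect_eq closed_Collect_le continuous_intros assms)

lemma closed_Collect_psd_bordered_on:
  assumes "continuous_on UNIV c" "\<And>i. continuous_on UNIV (\<lambda>x. y x i)"
    "\<And>i j. continuous_on UNIV (\<lambda>x. L x i j)"
  shows "closed {x. psd_bordered_on S (c x) (y x) (L x)}"
  unfolding psd_bordered_on_def
proof (rule closed_Collect_psd_on)
  show "continuous_on UNIV (\<lambda>x. bordered (c x) (y x) (L x) i j)" for i j
    using assms by (cases i; cases j) (simp_all add: bordered_def)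
qed

text \<open>In the product topology every constraint is an intersection of weak inequalities and
  equations between continuous functions of the coordinates. The premises of the implications do not
  involve \<open>x\<close>, so their truth sets are trivially open.\<close>

lemma closed_feasible: "closed {x. feasible n lam \<beta> x}"
  unfolding feasible_def constraint_A_def constraint_B_def constraint_C_def constraint_D_def Let_def
    Ball_def case_prod_beta
  by (intro closed_Collect_conj closed_Collect_all closed_Collect_imp open_Collect_const
      closed_Collect_eq closed_Collect_le continuous_intros closed_Collect_psd_on
      closed_Collect_psd_bordered_on continuous_block)

text \<open>Tychonoff's theorem for function types; it is applied once for each of the three
  arguments of a family.\<close>

lemma compact_Pi:
  fixes K :: "'a \<Rightarrow> 'b :: topological_space set"
  assumes "\<And>i. compact (K i)"
  shows "compact {f. \<forall>i. f i \<in> K i}"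
proof -
  have "compactin (product_topology (\<lambda>i. euclidean) UNIV) (PiE UNIV K)"
    using assms by (simp add: compactin_PiE)
  moreover have "PiE UNIV K = {f. \<forall>i. f i \<in> K i}" by (auto simp: PiE_def)
  ultimately show ?thesis by (simp add: euclidean_product_topology)
qed

text \<open>The chain is \<open>x i j t \<le> x i i i \<le> x 0 0 0 \<le> 1\<close>. Its middle step
  is a constraint of (A) at \<open>(i, i, i)\<close>, where the distance
  \<open>i + i - 2 * i\<close> is 0. The last step is the nonnegative corner of the bordered matrix
  in (B), obtained by testing with the unit vector at \<open>None\<close>.\<close>

lemma feasible_bounds:
  assumes "feasible n lam \<beta> x" "(i, j, t) \<in> I2 n"
  shows "x i j t \<in> {0..1}"
proof -
  have A: "0 \<le> x i j t" "x i j t \<le> x i i i"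
    using assms by (auto simp: feasible_def constraint_A_def)
  have "x i i i \<le> x (i + i - 2 * i) 0 0"
    using assms(1) I2_base(4)[OF assms(2)] unfolding feasible_def constraint_A_def by fastforce
  moreover have "x 0 0 0 \<le> 1"
  proof -
    have "psd_bordered_on {0..n} (1 - x 0 0 0)
       (\<lambda>i. real (n choose i) * (x 0 0 0 - x i 0 0)) (block n (compl_family x) 0)"
      using assms(1) by (simp add: feasible_def constraint_B_def)
    then have *: "0 \<le> (\<Sum>p\<in>insert None (Some ` {0..n}). \<Sum>q\<in>insert None (Some ` {0..n}).
        v p * bordered (1 - x 0 0 0) (\<lambda>i. real (n choose i) * (x 0 0 0 - x i 0 0)) (block n (compl_family x) 0) p q * v q)" for v
      by (simp add: psd_bordered_on_def psd_on_def)
    have "(\<Sum>p\<in>insert None (Some ` {0..n}). \<Sum>q\<in>insert None (Some ` {0..n}).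
        of_bool (p = None) * bordered (1 - x 0 0 0) (\<lambda>i. real (n choose i) * (x 0 0 0 - x i 0 0)) (block n (compl_family x) 0) p q * of_bool (q = None))
        = 1 - x 0 0 0"
      by (simp add: sum.insert sum.reindex bordered_def)
    with *[of "\<lambda>p. of_bool (p = None)"] show ?thesis by simp
  qed
  ultimately show ?thesis using A by simp
qed

lemma feasible_minimum_exists:
  assumes "feasible n lam \<beta> x0"
  shows "\<exists>x. is_arg_min (objective n) (feasible n lam \<beta>) x"
proof -
  define K where "K i j t = (if (i, j, t) \<in> I2 n then {0..1} else {0 :: real})" for i j t
  define trunc where "trunc x i j t = (if (i, j, t) \<in> I2 n then x i j t else 0)"
    for x :: "nat \<Rightarrow> nat \<Rightarrow> nat \<Rightarrow> real" and i j t
  have trunc: "eq_on_I2 n x (trunc x)" for x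
    by (auto intro: eq_on_I2I simp: trunc_def)
  define S where "S = {x. \<forall>i. x i \<in> {y. \<forall>j. y j \<in> {z. \<forall>t. z t \<in> K i j t}}} \<inter> {x. feasible n lam \<beta> x}"
  have "compact S"
    unfolding S_def
    by (intro compact_Int_closed closed_feasible compact_Pi) (auto simp: K_def)
  have mem: "trunc x \<in> S" if "feasible n lam \<beta> x" for x
    using feasible_bounds[OF that] feasible_eq_on_I2[OF trunc that]
    by (auto simp: S_def K_def trunc_def)
  have "continuous_on S (objective n)"
    unfolding objective_def case_prod_beta
    by (rule continuous_on_subset[OF _ subset_UNIV]) (intro continuous_intros)
  with \<open>compact S\<close> mem[OF assms] obtain x where x: "x \<in> S" "\<forall>y\<in>S. objective n x \<le> objective n y"
    using continuous_attains_inf[of S "objective n"] by blast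
  have "objective n x \<le> objective n y" if "feasible n lam \<beta> y" for y
    using x(2) mem[OF that] objective_eq_on_I2[OF trunc[of y]] by simp
  with x(1) show ?thesis
    by (auto simp: is_arg_min_def S_def not_less)
qed

section \<open>The orbit average of a code\<close>

lemma mset_triple_eq:
  assumes "{#a, b, c#} = {#x, y, z#}"
  shows "(a = x \<and> b = y \<or> a = y \<and> b = x) \<and> c = z \<or> (a = x \<and> b = z \<or> a = z \<and> b = x) \<and> c = y
    \<or> (a = y \<and> b = z \<or> a = z \<and> b = y) \<and> c = x"
proof -
  have "c \<in># {#x, y, z#}" using assms[symmetric] by simp
  then consider "c = z" | "c = y" | "c = x" by auto
  then show ?thesis
  proof cases
    case 1 
    with assms have "{#a, b#} = {#x, y#}" by (simp add: add_mset_commute)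
    with 1 show ?thesis by (auto simp: add_eq_conv_ex)
  next
    case 2
    with assms have "{#a, b#} = {#x, z#}" by (metis add_mset_commute add_mset_add_mset_same_iff)
    with 2 show ?thesis by (auto simp: add_eq_conv_ex)
  next
    case 3
    with assms have "{#a, b#} = {#y, z#}" by (metis add_mset_commute add_mset_add_mset_same_iff)
    with 3 show ?thesis by (auto simp: add_eq_conv_ex)
  qed
qed

text \<open>It converts a sum over types, weighted by how many objects have each type, into a sum
  over the objects. This removes \<open>eta\<close>, \<open>alpha\<close> and the multinomial
  coefficients alike.\<close>

lemma sum_card_fibres:
  assumes "finite S" "finite T"
  shows "(\<Sum>y\<in>T. real (card {w \<in> S. g w = y}) * F y) = (\<Sum>w | w \<in> S \<and> g w \<in> T. F (g w))"
proof -
  have "(\<Sum>y\<in>T. real (card {w \<in> S. g w = y}) * F y) = (\<Sum>y\<in>T. \<Sum>w | w \<in> {w \<in> S. g w \<in> T} \<and> g w = y. F (g w))"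
  proof (rule sum.cong[OF refl])
    fix y assume "y \<in> T"
    then have "{w. w \<in> {w \<in> S. g w \<in> T} \<and> g w = y} = {w \<in> S. g w = y}" by auto
    then show "real (card {w \<in> S. g w = y}) * F y = (\<Sum>w | w \<in> {w \<in> S. g w \<in> T} \<and> g w = y. F (g w))"
      by simp
  qed
  also have "\<dots> = (\<Sum>w | w \<in> S \<and> g w \<in> T. F (g w))"
    by (rule sum.group) (use assms in auto)
  finally show ?thesis .
qed

section \<open>The isometry group of the cube and invariance of sums over it\<close>

definition isometries :: "nat \<Rightarrow> ((nat \<Rightarrow> bit) \<times> (nat \<Rightarrow> nat)) set" where
  "isometries n = words n \<times> {\<pi>. \<pi> permutes {..<n}}"

text \<open>Functions carry a pointwise subtraction but no pointwise addition here; in characteristic 2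
  the two coincide.\<close>

definition iso_apply :: "(nat \<Rightarrow> bit) \<times> (nat \<Rightarrow> nat) \<Rightarrow> (nat \<Rightarrow> bit) \<Rightarrow> nat \<Rightarrow> bit" where
  "iso_apply \<omega> u = fst \<omega> - (u \<circ> snd \<omega>)"

lemma finite_isometries [simp]: "finite (isometries n)"
  by (simp add: isometries_def finite_permutations)

lemma isometries_nonempty: "isometries n \<noteq> {}"
proof -
  have "(zero_word, id) \<in> isometries n" by (simp add: isometries_def permutes_id)
  then show ?thesis by blast
qed

lemma word_diff_diff_cancel [simp]: "a - (a - u) = u" for a u :: "nat \<Rightarrow> bit"
proof
  show "(a - (a - u)) l = u l" for l by (cases "a l"; cases "u l") simp_all
qed

lemma word_diff_diff_cancel' [simp]: "a - u - u = a" for a u :: "nat \<Rightarrow> bit"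
proof
  show "(a - u - u) l = a l" for l by (cases "a l"; cases "u l") simp_all
qed

lemma word_diff_commute: "u - v = v - u" for u v :: "nat \<Rightarrow> bit"
proof
  show "(u - v) l = (v - u) l" for l by (cases "v l"; cases "u l") simp_all
qed

lemma word_diff_assoc: "a - (u - b) = a - b - u" for a u b :: "nat \<Rightarrow> bit"
proof
  show "(a - (u - b)) l = (a - b - u) l" for l by (cases "a l"; cases "u l"; cases "b l") simp_all
qed

lemma bij_betw_iso_apply:
  assumes "\<omega> \<in> isometries n"
  shows "bij_betw (iso_apply \<omega>) (words n) (words n)"
proof -
  have a: "fst \<omega> \<in> words n" and \<pi>: "snd \<omega> permutes {..<n}" using assms by (auto simp: isometries_def)
  have "bij_betw (\<lambda>u. fst \<omega> - u) (words n) (words n)"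
    by (rule bij_betw_byWitness[where f' = "\<lambda>u. fst \<omega> - u"]) (use a in auto)
  moreover have "iso_apply \<omega> = (\<lambda>u. fst \<omega> - u) \<circ> (\<lambda>u. u \<circ> snd \<omega>)"
    by (rule ext) (simp add: iso_apply_def)
  ultimately show ?thesis
    using bij_betw_trans[OF bij_betw_comp_permutes[OF \<pi>]] by (simp only:)
qed

lemma hamming_iso_apply:
  assumes "\<omega> \<in> isometries n"
  shows "hamming n (iso_apply \<omega> u) (iso_apply \<omega> v) = hamming n u v"
proof -
  have "snd \<omega> permutes {..<n}" using assms by (auto simp: isometries_def)
  moreover have "hamming n (fst \<omega> - (u \<circ> snd \<omega>)) (fst \<omega> - (v \<circ> snd \<omega>)) = hamming n (u \<circ> snd \<omega>) (v \<circ> snd \<omega>)"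
    by (simp only: word_diff_commute[of "fst \<omega>"] hamming_diff_words)
  ultimately show ?thesis by (simp add: iso_apply_def hamming_permuted)
qed

text \<open>Precomposing \<open>(a, \<pi>)\<close> with the translation by \<open>b\<close> gives
  \<open>(a - b \<circ> \<pi>, \<pi>)\<close>, and in characteristic 2 this map is an involution of
  the index set.\<close>

lemma sum_isometries_shift:
  assumes "b \<in> words n"
  shows "(\<Sum>\<omega>\<in>isometries n. f (\<lambda>u. iso_apply \<omega> (u - b))) = (\<Sum>\<omega>\<in>isometries n. f (iso_apply \<omega>))"
proof (rule sum.reindex_bij_witness[where i = "\<lambda>\<omega>. (fst \<omega> - (b \<circ> snd \<omega>), snd \<omega>)"
      and j = "\<lambda>\<omega>. (fst \<omega> - (b \<circ> snd \<omega>), snd \<omega>)"])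
  fix \<omega> assume "\<omega> \<in> isometries n"
  then show "(fst \<omega> - (b \<circ> snd \<omega>), snd \<omega>) \<in> isometries n"
    "(fst \<omega> - (b \<circ> snd \<omega>), snd \<omega>) \<in> isometries n"
    using assms by (auto simp: isometries_def comp_permutes_in_words)
  have "iso_apply (fst \<omega> - (b \<circ> snd \<omega>), snd \<omega>) u = iso_apply \<omega> (u - b)" for u
  proof -
    have "(u - b) \<circ> snd \<omega> = (u \<circ> snd \<omega>) - (b \<circ> snd \<omega>)" by (simp only: comp_def fun_diff_def)
    then show ?thesis by (simp only: iso_apply_def fst_conv snd_conv word_diff_assoc)
  qed
  then show "f (iso_apply (fst \<omega> - (b \<circ> snd \<omega>), snd \<omega>)) = f (\<lambda>u. iso_apply \<omega> (u - b))" by presburger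
qed (auto simp: prod_eq_iff simp del: minus_bit_def)

text \<open>Precomposition turns \<open>(a, \<pi>)\<close> into
  \<open>(a, \<rho> \<circ> \<pi>)\<close>, a bijection of the index set.\<close>

lemma sum_isometries_permute:
  assumes "\<rho> permutes {..<n}"
  shows "(\<Sum>\<omega>\<in>isometries n. f (\<lambda>u. iso_apply \<omega> (u \<circ> \<rho>))) = (\<Sum>\<omega>\<in>isometries n. f (iso_apply \<omega>))"
proof (rule sum.reindex_bij_witness[where i = "\<lambda>\<omega>. (fst \<omega>, inv \<rho> \<circ> snd \<omega>)"
      and j = "\<lambda>\<omega>. (fst \<omega>, \<rho> \<circ> snd \<omega>)"])
  fix \<omega> assume "\<omega> \<in> isometries n"
  then show "(fst \<omega>, \<rho> \<circ> snd \<omega>) \<in> isometries n" "(fst \<omega>, inv \<rho> \<circ> snd \<omega>) \<in> isometries n"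
    using assms by (auto simp: isometries_def permutes_compose permutes_inv)
  have "iso_apply (fst \<omega>, \<rho> \<circ> snd \<omega>) = (\<lambda>u. iso_apply \<omega> (u \<circ> \<rho>))"
    by (rule ext) (simp add: iso_apply_def comp_assoc)
  then show "f (iso_apply (fst \<omega>, \<rho> \<circ> snd \<omega>)) = f (\<lambda>u. iso_apply \<omega> (u \<circ> \<rho>))"
    by (simp only:)
qed (use assms in \<open>auto simp: permutes_inv_o simp flip: comp_assoc\<close>)

section \<open>Counting the pairs of words of a given type\<close>

lemma card_sets_meeting:
  assumes A: "A \<subseteq> {..<n}" and t: "t \<le> j"
  shows "card {B. B \<subseteq> {..<n} \<and> card B = j \<and> card (A \<inter> B) = t}
    = (card A choose t) * ((n - card A) choose (j - t))"
proof -
  have finA: "finite A" using A finite_subset by blast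
  let ?S = "{S. S \<subseteq> A \<and> card S = t}" and ?R = "{R. R \<subseteq> {..<n} - A \<and> card R = j - t}"
  have "bij_betw (\<lambda>(S, R). S \<union> R) (?S \<times> ?R) {B. B \<subseteq> {..<n} \<and> card B = j \<and> card (A \<inter> B) = t}"
  proof (rule bij_betw_byWitness[where f' = "\<lambda>B. (A \<inter> B, B - A)"])
    show "\<forall>p\<in>?S \<times> ?R. (\<lambda>B. (A \<inter> B, B - A)) (case p of (S, R) \<Rightarrow> S \<union> R) = p" by auto
    show "(\<lambda>(S, R). S \<union> R) ` (?S \<times> ?R) \<subseteq> {B. B \<subseteq> {..<n} \<and> card B = j \<and> card (A \<inter> B) = t}"
    proof clarify
      fix S R assume *: "S \<subseteq> A" "R \<subseteq> {..<n} - A" "t = card S" "card R = j - card S"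
      then have "finite S" "finite R" "S \<inter> R = {}"
        using finA finite_subset[of R "{..<n}"] finite_subset[of S A] by auto
      then have "card (S \<union> R) = card S + card R" by (rule card_Un_disjoint)
      moreover have "A \<inter> (S \<union> R) = S" using * by auto
      ultimately show "S \<union> R \<subseteq> {..<n} \<and> card (S \<union> R) = j \<and> card (A \<inter> (S \<union> R)) = card S"
        using * A t by auto
    qed
    show "(\<lambda>B. (A \<inter> B, B - A)) ` {B. B \<subseteq> {..<n} \<and> card B = j \<and> card (A \<inter> B) = t} \<subseteq> ?S \<times> ?R"
      using finA by (auto simp: card_Diff_subset_Int Int_commute)
  qed auto
  then have "card {B. B \<subseteq> {..<n} \<and> card B = j \<and> card (A \<inter> B) = t} = card ?S * card ?R"
    by (simp add: bij_betw_same_card[symmetric] card_cartesian_product)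
  also have "\<dots> = (card A choose t) * ((n - card A) choose (j - t))"
    using A finA by (simp add: n_subsets card_Diff_subset)
  finally show ?thesis .
qed

lemma multinom_choose:
  assumes "(i, j, t) \<in> I2 n"
  shows "multinom n (i - t) (j - t) t = real ((n choose i) * ((i choose t) * ((n - i) choose (j - t))))"
proof -
  from assms have *: "t \<le> i" "t \<le> j" "i \<le> n" "j - t \<le> n - i" by (auto simp: I2_def)
  then have "n - (i - t) - (j - t) - t = n - i - (j - t)" by simp
  then show ?thesis
    using * by (simp add: multinom_def binomial_fact)
qed

text \<open>The multinomial distributes the coordinates over "in \<open>u\<close> only", "in
  \<open>v\<close> only", "in both" and "in neither". The count chooses \<open>u\<close>, then its
  intersection with \<open>v\<close>, then the rest of \<open>v\<close>.\<close>

lemma card_pairs_dbar: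
  assumes "(i, j, t) \<in> I2 n"
  shows "real (card {p \<in> words n \<times> words n. (case p of (u, v) \<Rightarrow> dbar n u v) = (i, j, t)})
    = multinom n (i - t) (j - t) t"
proof -
  have t: "t \<le> j" using assms by (simp add: I2_def)
  let ?g = "\<lambda>p. (card (fst p), card (snd p), card (fst p \<inter> snd p))"
  have "bij_betw (map_prod word_of word_of) (Pow {..<n} \<times> Pow {..<n}) (words n \<times> words n)"
    by (intro bij_betw_map_prod bij_betw_word_of)
  then have "card {p \<in> words n \<times> words n. (case p of (u, v) \<Rightarrow> dbar n u v) = (i, j, t)}
      = card {p \<in> Pow {..<n} \<times> Pow {..<n}. ?g p = (i, j, t)}"
    by (rule card_Collect_bij_betw) (auto simp: dbar_word_of)
  also have "{p \<in> Pow {..<n} \<times> Pow {..<n}. ?g p = (i, j, t)}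
      = (SIGMA A:{A. A \<subseteq> {..<n} \<and> card A = i}. {B. B \<subseteq> {..<n} \<and> card B = j \<and> card (A \<inter> B) = t})"
    by auto
  also have "card \<dots> = (\<Sum>A | A \<subseteq> {..<n} \<and> card A = i. card {B. B \<subseteq> {..<n} \<and> card B = j \<and> card (A \<inter> B) = t})"
    by (intro card_SigmaI ballI) (auto intro: finite_subset[of _ "Pow {..<n}"])
  also have "\<dots> = (\<Sum>A | A \<subseteq> {..<n} \<and> card A = i. (i choose t) * ((n - i) choose (j - t)))"
    by (intro sum.cong refl) (auto simp: card_sets_meeting[OF _ t])
  also have "\<dots> = (n choose i) * ((i choose t) * ((n - i) choose (j - t)))"
    by (simp add: n_subsets)
  finally show ?thesis by (simp only: multinom_choose[OF assms])
qed

section \<open>The feasible point attached to a code\<close>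

locale covering_code =
  fixes n :: nat and lam :: "nat \<Rightarrow> real" and \<beta> :: real and C :: "(nat \<Rightarrow> bit) set"
  assumes C_words: "C \<subseteq> words n" and C_satisfies: "satisfies n lam \<beta> C"
begin

definition \<chi> :: "(nat \<Rightarrow> bit) \<times> (nat \<Rightarrow> nat) \<Rightarrow> (nat \<Rightarrow> bit) \<Rightarrow> real" where
  "\<chi> \<omega> u = of_bool (iso_apply \<omega> u \<in> C)"

definition avg :: "((nat \<Rightarrow> bit) \<times> (nat \<Rightarrow> nat) \<Rightarrow> real) \<Rightarrow> real" where
  "avg f = (\<Sum>\<omega>\<in>isometries n. f \<omega>) / real (card (isometries n))"

lemma \<chi>_idem [simp]: "\<chi> \<omega> u * \<chi> \<omega> u = \<chi> \<omega> u" "\<chi> \<omega> u * (\<chi> \<omega> u * a) = \<chi> \<omega> u * a"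
  by (simp_all add: \<chi>_def)

lemma card_isometries_pos: "real (card (isometries n)) > 0"
  using isometries_nonempty by (simp add: card_gt_0_iff)

lemma avg_add: "avg (\<lambda>\<omega>. f \<omega> + g \<omega>) = avg f + avg g"
  by (simp add: avg_def sum.distrib add_divide_distrib)

lemma avg_diff: "avg (\<lambda>\<omega>. f \<omega> - g \<omega>) = avg f - avg g"
  by (simp add: avg_def sum_subtractf diff_divide_distrib)

lemma avg_cmult: "avg (\<lambda>\<omega>. c * f \<omega>) = c * avg f"
  by (simp add: avg_def sum_distrib_left)

lemma avg_const: "avg (\<lambda>\<omega>. c) = c"
  using card_isometries_pos isometries_nonempty by (simp add: avg_def)

lemma avg_sum: "avg (\<lambda>\<omega>. \<Sum>a\<in>A. f a \<omega>) = (\<Sum>a\<in>A. avg (f a))"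
  unfolding avg_def sum_divide_distrib by (rule sum.swap)

lemma avg_mono: "(\<And>\<omega>. \<omega> \<in> isometries n \<Longrightarrow> f \<omega> \<le> g \<omega>) \<Longrightarrow> avg f \<le> avg g"
  unfolding avg_def by (intro divide_right_mono sum_mono) auto

lemma avg_cong: "(\<And>\<omega>. \<omega> \<in> isometries n \<Longrightarrow> f \<omega> = g \<omega>) \<Longrightarrow> avg f = avg g"
  by (simp add: avg_def)

text \<open>Products of three values are general enough: since \<open>\<chi>\<close> is idempotent,
  probabilities of one or two words are those of triples with repetitions.\<close>

lemma avg_shift:
  assumes "b \<in> words n"
  shows "avg (\<lambda>\<omega>. \<chi> \<omega> (u - b) * \<chi> \<omega> (v - b) * \<chi> \<omega> (w - b)) = avg (\<lambda>\<omega>. \<chi> \<omega> u * \<chi> \<omega> v * \<chi> \<omega> w)"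
  using sum_isometries_shift[OF assms, of "\<lambda>F. of_bool (F u \<in> C) * of_bool (F v \<in> C) * (of_bool (F w \<in> C) :: real)"]
  by (simp only: avg_def \<chi>_def)

lemma avg_permute:
  assumes "\<rho> permutes {..<n}"
  shows "avg (\<lambda>\<omega>. \<chi> \<omega> (u \<circ> \<rho>) * \<chi> \<omega> (v \<circ> \<rho>) * \<chi> \<omega> (w \<circ> \<rho>)) = avg (\<lambda>\<omega>. \<chi> \<omega> u * \<chi> \<omega> v * \<chi> \<omega> w)"
  using sum_isometries_permute[OF assms, of "\<lambda>F. of_bool (F u \<in> C) * of_bool (F v \<in> C) * (of_bool (F w \<in> C) :: real)"]
  by (simp only: avg_def \<chi>_def)

text \<open>The representatives are those of \<open>I2_witness\<close>, so the value is explicit.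
  Independence of the representatives is \<open>X_zero\<close> and rests on coordinate permutations,
  which fix the zero word.\<close>

definition X :: "nat \<Rightarrow> nat \<Rightarrow> nat \<Rightarrow> real" where
  "X i j t = avg (\<lambda>\<omega>. \<chi> \<omega> zero_word * \<chi> \<omega> (word_of {..<i}) * \<chi> \<omega> (word_of {i - t..<i + j - t}))"

lemma X_zero:
  assumes u: "u \<in> words n" and v: "v \<in> words n" and d: "dbar n u v = (i, j, t)"
  shows "X i j t = avg (\<lambda>\<omega>. \<chi> \<omega> zero_word * \<chi> \<omega> u * \<chi> \<omega> v)"
proof -
  have "(i, j, t) \<in> I2 n" using dbar_in_I2[of n u v] d by simp
  then have *: "t \<le> i" "t \<le> j" "i + j \<le> n + t" by (auto simp: I2_def)
  then have sub: "{..<i} \<subseteq> {..<n}" "{i - t..<i + j - t} \<subseteq> {..<n}" by auto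
  have "{..<i} \<inter> {i - t..<i + j - t} = {i - t..<i}" using * by auto
  then have "dbar n (word_of {..<i}) (word_of {i - t..<i + j - t}) = dbar n u v"
    using * by (simp add: dbar_word_of[OF sub] d)
  then obtain \<pi> where \<pi>: "\<pi> permutes {..<n}" "u = word_of {..<i} \<circ> \<pi>" "v = word_of {i - t..<i + j - t} \<circ> \<pi>"
    using dbar_eq_imp_permutes word_of_in_words[OF sub(1)] word_of_in_words[OF sub(2)] u v by metis
  have "zero_word \<circ> \<pi> = zero_word" by auto
  with avg_permute[OF \<pi>(1), of zero_word "word_of {..<i}" "word_of {i - t..<i + j - t}"]
  show ?thesis by (simp add: X_def \<pi>(2,3))
qed

text \<open>Translation by \<open>w\<close> reduces to the case where the third word is zero. The
  right-hand side is symmetric in \<open>u\<close>, \<open>v\<close>, \<open>w\<close>, and from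
  this the permutation constraint in (A) follows.\<close>

lemma X_eq:
  assumes "u \<in> words n" "v \<in> words n" "w \<in> words n" and "dbar n (u - w) (v - w) = (i, j, t)"
  shows "X i j t = avg (\<lambda>\<omega>. \<chi> \<omega> u * \<chi> \<omega> v * \<chi> \<omega> w)"
proof -
  have "X i j t = avg (\<lambda>\<omega>. \<chi> \<omega> (w - w) * \<chi> \<omega> (u - w) * \<chi> \<omega> (v - w))"
    using X_zero[OF _ _ assms(4)] assms(1-3) by simp
  also have "\<dots> = avg (\<lambda>\<omega>. \<chi> \<omega> u * \<chi> \<omega> v * \<chi> \<omega> w)"
    unfolding avg_shift[OF assms(3)] by (simp add: mult_ac)
  finally show ?thesis .
qed

lemma X_pair:
  assumes "u \<in> words n" "v \<in> words n" and "hamming n u v = m"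
  shows "X m 0 0 = avg (\<lambda>\<omega>. \<chi> \<omega> u * \<chi> \<omega> v)"
proof -
  have "weight n (u - v) = m" by (simp only: weight_diff assms(3))
  moreover from this have "hamming n (u - v) zero_word = m" by (simp only: weight_def)
  moreover have "weight n zero_word = 0" by (simp add: weight_def hamming_def)
  ultimately have "dbar n (u - v) (v - v) = (m, 0, 0)" by (simp add: dbar_eq_iff_hamming)
  from X_eq[OF assms(1,2,2) this] show ?thesis by (simp add: mult.assoc)
qed

lemma X_point:
  assumes "u \<in> words n"
  shows "X 0 0 0 = avg (\<lambda>\<omega>. \<chi> \<omega> u)"
proof -
  have "hamming n u u = 0" by (simp add: hamming_def)
  from X_pair[OF assms assms this] show ?thesis by (simp only: \<chi>_idem)
qed

text \<open>A dictionary between the entries occurring in the constraints and averages of products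
  of \<open>\<chi>\<close>. The entry \<open>X 0 0 0\<close> may be read at any of the three words,
  and later proofs pick the reading that makes the integrand factor.\<close>

lemma X_entries:
  assumes "u \<in> words n" "v \<in> words n" "dbar n u v = (i, j, t)"
  shows "X i j t = avg (\<lambda>\<omega>. \<chi> \<omega> zero_word * \<chi> \<omega> u * \<chi> \<omega> v)"
    and "X (i + j - 2 * t) 0 0 = avg (\<lambda>\<omega>. \<chi> \<omega> u * \<chi> \<omega> v)"
    and "X i 0 0 = avg (\<lambda>\<omega>. \<chi> \<omega> zero_word * \<chi> \<omega> u)"
    and "X j 0 0 = avg (\<lambda>\<omega>. \<chi> \<omega> zero_word * \<chi> \<omega> v)"
    and "X i i i = avg (\<lambda>\<omega>. \<chi> \<omega> zero_word * \<chi> \<omega> u)"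
    and "X 0 0 0 = avg (\<lambda>\<omega>. \<chi> \<omega> zero_word)"
    and "X 0 0 0 = avg (\<lambda>\<omega>. \<chi> \<omega> u)"
    and "X 0 0 0 = avg (\<lambda>\<omega>. \<chi> \<omega> v)"
proof -
  note h = hamming_dbar[OF assms(3)] and w = dbar_weight[OF assms(3)]
  show "X i j t = avg (\<lambda>\<omega>. \<chi> \<omega> zero_word * \<chi> \<omega> u * \<chi> \<omega> v)"
    by (rule X_zero[OF assms])
  show "X (i + j - 2 * t) 0 0 = avg (\<lambda>\<omega>. \<chi> \<omega> u * \<chi> \<omega> v)"
    using h by (intro X_pair assms) simp
  show i: "X i 0 0 = avg (\<lambda>\<omega>. \<chi> \<omega> zero_word * \<chi> \<omega> u)"
    and "X j 0 0 = avg (\<lambda>\<omega>. \<chi> \<omega> zero_word * \<chi> \<omega> v)"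
    using w by (auto intro!: X_pair assms simp: weight_def hamming_commute[of n zero_word])
  have "dbar n u u = (i, i, i)" using w by (simp add: dbar_eq_iff_hamming) (simp add: hamming_def)
  from X_zero[OF assms(1,1) this] show "X i i i = avg (\<lambda>\<omega>. \<chi> \<omega> zero_word * \<chi> \<omega> u)"
    by (simp add: mult.assoc)
qed (rule X_point, use assms in simp)+

lemma constraint_A_X: "constraint_A n X"
  unfolding constraint_A_def
proof clarify
  fix i j t assume ijt: "(i, j, t) \<in> I2 n"
  then obtain u v where uv: "u \<in> words n" "v \<in> words n" "dbar n u v = (i, j, t)"
    by (rule I2_dbar_witness)
  note X = X_entries[OF uv]
  have "0 \<le> X i j t"
    using avg_mono[of "\<lambda>_. 0" "\<lambda>\<omega>. \<chi> \<omega> zero_word * \<chi> \<omega> u * \<chi> \<omega> v"]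
    by (simp add: X(1) avg_const \<chi>_def)
  moreover have "X i j t \<le> X i i i"
    unfolding X(1,5) by (rule avg_mono) (auto simp: \<chi>_def)
  \<comment> \<open>With \<open>X 0 0 0\<close> read at \<open>u\<close>, the difference of the two
    sides is the average of \<open>\<chi> \<omega> u\<close> times the complements of
    \<open>\<chi>\<close> at zero and at \<open>v\<close>, hence nonnegative.\<close>
  moreover have "X i 0 0 + X (i + j - 2 * t) 0 0 - X 0 0 0 \<le> X i j t"
    unfolding X(1-3,7) avg_add[symmetric] avg_diff[symmetric] by (rule avg_mono) (auto simp: \<chi>_def)
  moreover have "X i j t \<le> X (i + j - 2 * t) 0 0"
    unfolding X(1,2) by (rule avg_mono) (auto simp: \<chi>_def)
  moreover have "X i j t = X i' j' t'" if "(i', j', t') \<in> I2 n"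
    "{#i, j, i + j - 2 * t#} = {#i', j', i' + j' - 2 * t'#}" for i' j' t'
  proof -
    define m where "m = i + j - 2 * t"
    have le: "2 * t \<le> i + j" "2 * t' \<le> i' + j'" using ijt that(1) by (auto simp: I2_def)
    have d: "hamming n u zero_word = i" "hamming n zero_word u = i" "hamming n v zero_word = j"
      "hamming n zero_word v = j" "hamming n u v = m" "hamming n v u = m"
      using dbar_weight[OF uv(3)] hamming_dbar[OF uv(3)]
      by (auto simp: m_def weight_def hamming_commute[of n zero_word] hamming_commute[of n v u])
    have perm: "X i' j' t' = avg (\<lambda>\<omega>. \<chi> \<omega> a * \<chi> \<omega> b * \<chi> \<omega> c)"
      if "a \<in> words n" "b \<in> words n" "c \<in> words n"
        "hamming n a c = i'" "hamming n b c = j'" "hamming n a b = i' + j' - 2 * t'" for a b c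
      by (rule X_eq) (use that le in \<open>auto simp: dbar_eq_iff_hamming weight_diff hamming_diff_words\<close>)
    have "(i' = i \<and> j' = j \<or> i' = j \<and> j' = i) \<and> i' + j' - 2 * t' = m
       \<or> (i' = i \<and> j' = m \<or> i' = m \<and> j' = i) \<and> i' + j' - 2 * t' = j
       \<or> (i' = j \<and> j' = m \<or> i' = m \<and> j' = j) \<and> i' + j' - 2 * t' = i"
      using mset_triple_eq[OF that(2)[unfolded m_def[symmetric], symmetric]] by blast
    \<comment> \<open>Each of the six assignments of the distances is realized by feeding zero,
      \<open>u\<close> and \<open>v\<close> to \<open>perm\<close> in the corresponding
      order.\<close>
    then have "X i' j' t' = avg (\<lambda>\<omega>. \<chi> \<omega> zero_word * \<chi> \<omega> u * \<chi> \<omega> v)"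
    proof (elim disjE conjE)
      assume "i' = i" "j' = j" "i' + j' - 2 * t' = m"
      with d perm[OF uv(1,2) zero_in_words] show ?thesis by (simp add: mult_ac)
    next
      assume "i' = j" "j' = i" "i' + j' - 2 * t' = m"
      with d perm[OF uv(2,1) zero_in_words] show ?thesis by (simp add: mult_ac)
    next
      assume "i' = i" "j' = m" "i' + j' - 2 * t' = j"
      with d perm[OF zero_in_words uv(2,1)] show ?thesis by (simp add: mult_ac)
    next
      assume "i' = m" "j' = i" "i' + j' - 2 * t' = j"
      with d perm[OF uv(2) zero_in_words uv(1)] show ?thesis by (simp add: mult_ac)
    next
      assume "i' = j" "j' = m" "i' + j' - 2 * t' = i"
      with d perm[OF zero_in_words uv(1,2)] show ?thesis by (simp add: mult_ac)
    next
      assume "i' = m" "j' = j" "i' + j' - 2 * t' = i"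
      with d perm[OF uv(1) zero_in_words uv(2)] show ?thesis by (simp add: mult_ac)
    qed
    then show ?thesis using X(1) by simp
  qed
  ultimately show "0 \<le> X i j t \<and> X i j t \<le> X i i i \<and>
      X i 0 0 + X (i + j - 2 * t) 0 0 - X 0 0 0 \<le> X i j t \<and> X i j t \<le> X (i + j - 2 * t) 0 0 \<and>
      (\<forall>(i', j', t')\<in>I2 n. {#i, j, i + j - 2 * t#} = {#i', j', i' + j' - 2 * t'#} \<longrightarrow> X i j t = X i' j' t')"
    by auto
qed

section \<open>The semidefinite constraints as averages of Gram matrices\<close>

lemma gram_family_avg:
  assumes "\<And>\<omega>. \<omega> \<in> isometries n \<Longrightarrow> 0 \<le> q \<omega>"
    and "\<And>u v i j t. u \<in> words n \<Longrightarrow> v \<in> words n \<Longrightarrow> dbar n u v = (i, j, t) \<Longrightarrow>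
      x i j t = avg (\<lambda>\<omega>. q \<omega> * \<chi> \<omega> u * \<chi> \<omega> v)"
  shows "gram_family n (isometries n) (\<lambda>\<omega>. q \<omega> / real (card (isometries n))) \<chi> x"
  unfolding gram_family_def
proof (intro conjI ballI allI impI)
  show "0 \<le> q \<omega> / real (card (isometries n))" if "\<omega> \<in> isometries n" for \<omega>
    using assms(1)[OF that] by simp
  show "x i j t = (\<Sum>\<omega>\<in>isometries n. q \<omega> / real (card (isometries n)) * \<chi> \<omega> u * \<chi> \<omega> v)"
    if "u \<in> words n" "v \<in> words n" "dbar n u v = (i, j, t)" for u v i j t
    using assms(2)[OF that] by (simp add: avg_def sum_divide_distrib)
qed

lemma psd_bordered_on_avg:
  assumes "\<And>\<omega>. \<omega> \<in> isometries n \<Longrightarrow> 0 \<le> q \<omega>"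
    and "\<And>u v i j t. u \<in> words n \<Longrightarrow> v \<in> words n \<Longrightarrow> dbar n u v = (i, j, t) \<Longrightarrow>
      x i j t = avg (\<lambda>\<omega>. q \<omega> * \<chi> \<omega> u * \<chi> \<omega> v)"
    and "c = avg q"
    and "\<And>u. u \<in> words n \<Longrightarrow> y (weight n u) = avg (\<lambda>\<omega>. q \<omega> * \<chi> \<omega> u)"
  shows "psd_bordered_on {0..n} c (\<lambda>i. real (n choose i) * y i) (block n x 0)"
  by (rule gram_family_psd_bordered_on[OF gram_family_avg[OF assms(1,2)] _ refl])
    (use assms(3,4) in \<open>auto simp: avg_def sum_divide_distrib\<close>)

text \<open>The two variables are \<open>q = \<chi> \<omega> zero_word\<close> and
  \<open>q = 1 - \<chi> \<omega> zero_word\<close>. For the first, \<open>q\<close> times the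
  constant 1 equals \<open>q\<close> times the coordinate of \<open>\<chi>\<close> at zero, so a
  border would only repeat the row \<open>i = 0\<close>. For the second, corner and border are the
  averages of \<open>q\<close> and of \<open>q * \<chi> \<omega> u\<close>.\<close>

lemma constraint_B_X: "constraint_B n X"
proof -
  have X: "gram_family n (isometries n) (\<lambda>\<omega>. \<chi> \<omega> zero_word / real (card (isometries n))) \<chi> X"
    by (rule gram_family_avg) (auto simp: X_zero \<chi>_def)
  have q: "0 \<le> 1 - \<chi> \<omega> zero_word" for \<omega> by (simp add: \<chi>_def)
  have cX: "compl_family X i j t = avg (\<lambda>\<omega>. (1 - \<chi> \<omega> zero_word) * \<chi> \<omega> u * \<chi> \<omega> v)"
    if "u \<in> words n" "v \<in> words n" "dbar n u v = (i, j, t)" for u v i j t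
    unfolding compl_family_def X_entries(1,2)[OF that] avg_diff[symmetric] by (simp add: algebra_simps)
  have c: "1 - X 0 0 0 = avg (\<lambda>\<omega>. 1 - \<chi> \<omega> zero_word)"
    by (simp add: avg_diff avg_const X_point)
  have y: "X 0 0 0 - X (weight n u) 0 0 = avg (\<lambda>\<omega>. (1 - \<chi> \<omega> zero_word) * \<chi> \<omega> u)" if u: "u \<in> words n" for u
    unfolding X_point[OF u] X_pair[OF u zero_in_words weight_def[symmetric]] avg_diff[symmetric]
    by (simp add: algebra_simps)
  have "2 * k \<le> n" if "k \<in> {1..n div 2}" for k using that by auto
  then show ?thesis
    unfolding constraint_B_def
    using gram_family_psd_on[OF X] gram_family_psd_on[OF gram_family_avg[OF q cX]]
      gram_family_psd_on[OF X, of 0] psd_bordered_on_avg[where q = "\<lambda>\<omega>. 1 - \<chi> \<omega> zero_word", OF q cX c y]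
    by simp
qed

text \<open>The hypothesis on \<open>C\<close> is used at the image of \<open>v\<close>. Reindexing
  the words by the isometry, which preserves distances, turns it into the same inequality at
  \<open>v\<close> for the preimage of \<open>C\<close>.\<close>

lemma covering:
  assumes "v \<in> words n" "\<omega> \<in> isometries n"
  shows "\<beta> \<le> (\<Sum>w\<in>words n. lam (hamming n v w) * \<chi> \<omega> w)"
proof -
  note bij = bij_betw_iso_apply[OF assms(2)]
  have v': "iso_apply \<omega> v \<in> words n" using bij assms(1) by (auto simp: bij_betw_def)
  have "\<beta> \<le> (\<Sum>i=0..n. lam i * real (card (C \<inter> sphere_of n i (iso_apply \<omega> v))))"
    using C_satisfies v' by (simp add: satisfies_def)
  also have "\<dots> = (\<Sum>i=0..n. \<Sum>w | w \<in> words n \<and> hamming n (iso_apply \<omega> v) w = i.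
      lam (hamming n (iso_apply \<omega> v) w) * of_bool (w \<in> C))"
  proof (rule sum.cong[OF refl])
    fix i
    let ?S = "{w \<in> words n. hamming n (iso_apply \<omega> v) w = i}"
    have "C \<inter> sphere_of n i (iso_apply \<omega> v) = ?S \<inter> C"
      by (auto simp: sphere_of_def)
    then have "lam i * real (card (C \<inter> sphere_of n i (iso_apply \<omega> v))) = (\<Sum>w\<in>?S. lam i * of_bool (w \<in> C))"
      by (simp flip: sum_distrib_left)
    then show "lam i * real (card (C \<inter> sphere_of n i (iso_apply \<omega> v)))
        = (\<Sum>w\<in>?S. lam (hamming n (iso_apply \<omega> v) w) * of_bool (w \<in> C))" by simp
  qed
  also have "\<dots> = (\<Sum>w\<in>words n. lam (hamming n (iso_apply \<omega> v) w) * of_bool (w \<in> C))"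
    by (rule sum.group) (auto simp: hamming_le)
  also have "\<dots> = (\<Sum>w\<in>words n. lam (hamming n (iso_apply \<omega> v) (iso_apply \<omega> w)) * of_bool (iso_apply \<omega> w \<in> C))"
    by (rule sum.reindex_bij_betw[OF bij, symmetric])
  finally show ?thesis by (simp add: hamming_iso_apply[OF assms(2)] \<chi>_def)
qed

text \<open>The excess in the covering inequality at the zero word, serving as the variable
  \<open>q\<close> in (C).\<close>

definition slack :: "(nat \<Rightarrow> bit) \<times> (nat \<Rightarrow> nat) \<Rightarrow> real" where
  "slack \<omega> = (\<Sum>w\<in>words n. lam (weight n w) * \<chi> \<omega> w) - \<beta>"

lemma slack_nonneg: "\<omega> \<in> isometries n \<Longrightarrow> 0 \<le> slack \<omega>"
  using covering[OF zero_in_words] by (simp add: slack_def weight_def hamming_commute[of n zero_word])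

text \<open>\<open>eta\<close> counts the words \<open>w\<close> of weight \<open>d\<close> by the
  type of \<open>(u - w, v - w)\<close>, and the entry of \<open>X\<close> at that type is the
  probability that \<open>u\<close>, \<open>v\<close>, \<open>w\<close> all land in
  \<open>C\<close>. The double sum is therefore one sum over all \<open>w\<close> weighted by
  \<open>lam (weight n w)\<close>; subtracting \<open>\<beta>\<close> times the probability for
  \<open>u\<close>, \<open>v\<close> leaves the factor \<open>slack\<close>.\<close>

lemma z_family_X:
  assumes uv: "u \<in> words n" "v \<in> words n" "dbar n u v = (i, j, t)"
  shows "z_family n lam \<beta> X i j t = avg (\<lambda>\<omega>. slack \<omega> * \<chi> \<omega> u * \<chi> \<omega> v)"
proof -
  have "(\<Sum>(i', j', t')\<in>I2 n. lam d * real (eta n (i, j, t) (i', j', t') d) * X i' j' t')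
      = (\<Sum>w | w \<in> words n \<and> weight n w = d. lam (weight n w) * avg (\<lambda>\<omega>. \<chi> \<omega> w * \<chi> \<omega> u * \<chi> \<omega> v))" for d
  proof -
    let ?S = "{w \<in> words n. weight n w = d}" and ?g = "\<lambda>w. dbar n (u - w) (v - w)"
    have "(\<Sum>(i', j', t')\<in>I2 n. lam d * real (eta n (i, j, t) (i', j', t') d) * X i' j' t')
        = lam d * (\<Sum>y\<in>I2 n. real (card {w \<in> ?S. ?g w = y}) * (case y of (i', j', t') \<Rightarrow> X i' j' t'))"
      by (auto simp: sum_distrib_left eta_eq[OF uv] mult_ac intro!: sum.cong)
    also have "\<dots> = lam d * (\<Sum>w | w \<in> ?S \<and> ?g w \<in> I2 n. case ?g w of (i', j', t') \<Rightarrow> X i' j' t')"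
      by (subst sum_card_fibres) auto
    also have "(\<Sum>w | w \<in> ?S \<and> ?g w \<in> I2 n. case ?g w of (i', j', t') \<Rightarrow> X i' j' t')
        = (\<Sum>w\<in>?S. avg (\<lambda>\<omega>. \<chi> \<omega> w * \<chi> \<omega> u * \<chi> \<omega> v))"
    proof (rule sum.cong)
      fix w assume w: "w \<in> ?S"
      obtain i' j' t' where g: "?g w = (i', j', t')" by (cases "?g w")
      from X_eq[OF uv(1,2) _ g] w show "(case ?g w of (i', j', t') \<Rightarrow> X i' j' t')
          = avg (\<lambda>\<omega>. \<chi> \<omega> w * \<chi> \<omega> u * \<chi> \<omega> v)"
        by (simp add: g mult_ac)
    qed (auto simp: dbar_in_I2)
    finally show ?thesis by (simp add: sum_distrib_left)
  qed
  then have "z_family n lam \<beta> X i j t = (\<Sum>d=0..n. \<Sum>w | w \<in> words n \<and> weight n w = d.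
      lam (weight n w) * avg (\<lambda>\<omega>. \<chi> \<omega> w * \<chi> \<omega> u * \<chi> \<omega> v)) - \<beta> * X (i + j - 2 * t) 0 0"
    by (simp add: z_family_def)
  also have "\<dots> = (\<Sum>w\<in>words n. lam (weight n w) * avg (\<lambda>\<omega>. \<chi> \<omega> w * \<chi> \<omega> u * \<chi> \<omega> v)) - \<beta> * X (i + j - 2 * t) 0 0"
    by (subst sum.group) (auto simp: weight_def hamming_le)
  also have "\<dots> = avg (\<lambda>\<omega>. (\<Sum>w\<in>words n. lam (weight n w) * (\<chi> \<omega> w * \<chi> \<omega> u * \<chi> \<omega> v)) - \<beta> * (\<chi> \<omega> u * \<chi> \<omega> v))"
    by (simp only: X_entries(2)[OF uv] avg_diff avg_sum avg_cmult)
  also have "\<dots> = avg (\<lambda>\<omega>. slack \<omega> * \<chi> \<omega> u * \<chi> \<omega> v)"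
    unfolding slack_def left_diff_distrib sum_distrib_right by (simp only: mult.assoc)
  finally show ?thesis .
qed

text \<open>The corner is the average of \<open>slack\<close>, the \<open>n choose i\<close> words
  of weight \<open>i\<close> having equal probabilities. The border uses the diagonal entries
  because \<open>(i, i, i)\<close> is the type of \<open>(u, u)\<close> and \<open>\<chi>\<close> is
  idempotent.\<close>

lemma constraint_C_X: "constraint_C n lam \<beta> X"
proof -
  have "(\<Sum>i=0..n. real (n choose i) * lam i * X 0 0 0)
      = (\<Sum>i=0..n. \<Sum>w | w \<in> words n \<and> weight n w = i. lam (weight n w) * X 0 0 0)"
    by (simp add: card_words_weight mult.assoc)
  also have "\<dots> = (\<Sum>w\<in>words n. lam (weight n w) * X 0 0 0)"
    by (rule sum.group) (auto simp: weight_def hamming_le)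
  also have "\<dots> = (\<Sum>w\<in>words n. lam (weight n w) * avg (\<lambda>\<omega>. \<chi> \<omega> w))"
    by (simp add: X_point)
  finally have c: "(\<Sum>i=0..n. real (n choose i) * lam i * X 0 0 0) - \<beta> = avg slack"
    unfolding slack_def[abs_def] by (simp add: avg_diff avg_sum avg_cmult avg_const)
  have y: "z_family n lam \<beta> X (weight n u) (weight n u) (weight n u) = avg (\<lambda>\<omega>. slack \<omega> * \<chi> \<omega> u)"
    if u: "u \<in> words n" for u
  proof -
    have "dbar n u u = (weight n u, weight n u, weight n u)"
      by (simp add: dbar_eq_iff_hamming) (simp add: hamming_def)
    from z_family_X[OF u u this] show ?thesis by (simp add: mult.assoc)
  qed
  have "2 * k \<le> n" if "k \<in> {1..n div 2}" for k using that by auto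
  then show ?thesis
    unfolding constraint_C_def Let_def
    using gram_family_psd_on[OF gram_family_avg[OF slack_nonneg z_family_X]]
      psd_bordered_on_avg[where y = "\<lambda>i. z_family n lam \<beta> X i i i", OF slack_nonneg z_family_X c y]
    by simp
qed

text \<open>\<open>alpha\<close> counts the words \<open>w\<close> by their type relative to
  \<open>u\<close> and their distance from \<open>v\<close>, so summing over both amounts to summing
  over all words.\<close>

lemma sum_lam_coeff:
  assumes uv: "u \<in> words n" "v \<in> words n" "dbar n u v = (i, j, t)"
  shows "(\<Sum>(j', t') | (i, j', t') \<in> I2 n. F j' t' * lam_coeff n lam i j t j' t')
    = (\<Sum>w\<in>words n. lam (hamming n v w) * F (fst (snd (dbar n u w))) (snd (snd (dbar n u w))))"
proof -
  let ?J = "{(j', t'). (i, j', t') \<in> I2 n}" and ?g = "\<lambda>w. snd (dbar n u w)"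
  have finJ: "finite ?J"
    by (rule finite_subset[of _ "{..n} \<times> {..n}"]) (auto simp: I2_def)
  have fst: "fst (dbar n u w) = i" for w using uv(3) by (auto simp: dbar_def)
  have g: "dbar n u w = (i, j', t') \<longleftrightarrow> ?g w = (j', t')" for w j' t'
    using fst[of w] by (auto simp: prod_eq_iff)
  have gJ: "?g w \<in> ?J" for w
    using dbar_in_I2[of n u w] fst[of w] by (cases "dbar n u w") auto
  have "(\<Sum>(j', t')\<in>?J. F j' t' * lam_coeff n lam i j t j' t')
      = (\<Sum>d=0..n. \<Sum>(j', t')\<in>?J. F j' t' * (lam d * real (alpha n (i, j, t) (i, j', t') d)))"
    unfolding lam_coeff_def sum_distrib_left case_prod_beta by (rule sum.swap)
  also have "\<dots> = (\<Sum>d=0..n. \<Sum>w | w \<in> words n \<and> hamming n v w = d. lam (hamming n v w) * F (fst (?g w)) (snd (?g w)))"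
  proof (rule sum.cong[OF refl])
    fix d
    let ?S = "{w \<in> words n. hamming n v w = d}"
    have "(\<Sum>(j', t')\<in>?J. F j' t' * (lam d * real (alpha n (i, j, t) (i, j', t') d)))
        = (\<Sum>y\<in>?J. real (card {w \<in> ?S. ?g w = y}) * (lam d * F (fst y) (snd y)))"
      by (rule sum.cong) (auto simp: alpha_eq[OF uv] g conj_ac mult_ac)
    also have "\<dots> = (\<Sum>w | w \<in> ?S \<and> ?g w \<in> ?J. lam d * F (fst (?g w)) (snd (?g w)))"
      using finJ by (subst sum_card_fibres) auto
    also have "\<dots> = (\<Sum>w\<in>?S. lam (hamming n v w) * F (fst (?g w)) (snd (?g w)))"
      by (rule sum.cong) (use gJ in auto)
    finally show "(\<Sum>(j', t')\<in>?J. F j' t' * (lam d * real (alpha n (i, j, t) (i, j', t') d)))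
        = (\<Sum>w\<in>?S. lam (hamming n v w) * F (fst (?g w)) (snd (?g w)))" by simp
  qed
  also have "\<dots> = (\<Sum>w\<in>words n. lam (hamming n v w) * F (fst (?g w)) (snd (?g w)))"
    by (rule sum.group) (auto simp: hamming_le)
  finally show ?thesis .
qed

text \<open>The covering inequality at \<open>v\<close> is multiplied by a nonnegative variable
  \<open>s\<close> and averaged. All of (D) results from different choices of
  \<open>s\<close>.\<close>

lemma covering_avg:
  assumes uv: "u \<in> words n" "v \<in> words n" "dbar n u v = (i, j, t)"
    and s: "\<And>\<omega>. \<omega> \<in> isometries n \<Longrightarrow> 0 \<le> s \<omega>"
    and F: "\<And>w j' t'. w \<in> words n \<Longrightarrow> dbar n u w = (i, j', t') \<Longrightarrow> F j' t' = avg (\<lambda>\<omega>. s \<omega> * \<chi> \<omega> w)"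
  shows "avg s * \<beta> \<le> (\<Sum>(j', t') | (i, j', t') \<in> I2 n. F j' t' * lam_coeff n lam i j t j' t')"
proof -
  have "avg s * \<beta> = avg (\<lambda>\<omega>. \<beta> * s \<omega>)" by (simp add: avg_cmult)
  also have "\<dots> \<le> avg (\<lambda>\<omega>. (\<Sum>w\<in>words n. lam (hamming n v w) * \<chi> \<omega> w) * s \<omega>)"
    by (intro avg_mono mult_right_mono covering uv s)
  also have "\<dots> = (\<Sum>w\<in>words n. lam (hamming n v w) * avg (\<lambda>\<omega>. s \<omega> * \<chi> \<omega> w))"
    unfolding sum_distrib_right avg_sum avg_cmult[symmetric] by (simp add: mult_ac)
  also have "\<dots> = (\<Sum>w\<in>words n. lam (hamming n v w) * F (fst (snd (dbar n u w))) (snd (snd (dbar n u w))))"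
  proof (rule sum.cong[OF refl])
    fix w assume w: "w \<in> words n"
    have "dbar n u w = (i, fst (snd (dbar n u w)), snd (snd (dbar n u w)))"
      using uv(3) by (auto simp: dbar_def)
    from F[OF w this] show "lam (hamming n v w) * avg (\<lambda>\<omega>. s \<omega> * \<chi> \<omega> w)
      = lam (hamming n v w) * F (fst (snd (dbar n u w))) (snd (snd (dbar n u w)))" by simp
  qed
  finally show ?thesis unfolding sum_lam_coeff[OF uv] .
qed

text \<open>The four inequalities come from the four products \<open>s\<close> of
  \<open>\<chi>\<close> or \<open>1 - \<chi>\<close> at zero with \<open>\<chi>\<close> or
  \<open>1 - \<chi>\<close> at \<open>u\<close>, the indicators of the four events for these two
  words. Expanding \<open>s\<close> and \<open>s * \<chi> \<omega> w\<close> gives the two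
  sides.\<close>

lemma constraint_D_X: "constraint_D n lam \<beta> X"
  unfolding constraint_D_def Let_def
proof clarify
  fix i j t assume "(i, j, t) \<in> I2 n"
  then obtain u v where uv: "u \<in> words n" "v \<in> words n" "dbar n u v = (i, j, t)"
    by (rule I2_dbar_witness)
  note c = covering_avg[OF uv]
  have 1: "X i 0 0 = avg (\<lambda>\<omega>. \<chi> \<omega> zero_word * \<chi> \<omega> u)" using X_entries[OF uv] by simp
  have 2: "X 0 0 0 - X i 0 0 = avg (\<lambda>\<omega>. \<chi> \<omega> zero_word * (1 - \<chi> \<omega> u))"
    unfolding X_entries(3,6)[OF uv] avg_diff[symmetric] by (simp add: algebra_simps)
  have 3: "X 0 0 0 - X i 0 0 = avg (\<lambda>\<omega>. (1 - \<chi> \<omega> zero_word) * \<chi> \<omega> u)"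
    unfolding X_entries(3,7)[OF uv] avg_diff[symmetric] by (simp add: algebra_simps)
  have "1 - 2 * X 0 0 0 + X i 0 0 = avg (\<lambda>\<omega>. 1) - avg (\<lambda>\<omega>. \<chi> \<omega> zero_word) - avg (\<lambda>\<omega>. \<chi> \<omega> u)
      + avg (\<lambda>\<omega>. \<chi> \<omega> zero_word * \<chi> \<omega> u)"
    unfolding avg_const X_entries(6,7)[OF uv, symmetric] X_entries(3)[OF uv, symmetric] by simp
  also have "\<dots> = avg (\<lambda>\<omega>. (1 - \<chi> \<omega> zero_word) * (1 - \<chi> \<omega> u))"
    unfolding avg_diff[symmetric] avg_add[symmetric] by (simp add: algebra_simps)
  finally have 4: "1 - 2 * X 0 0 0 + X i 0 0 = avg (\<lambda>\<omega>. (1 - \<chi> \<omega> zero_word) * (1 - \<chi> \<omega> u))" .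
  show "X i 0 0 * \<beta> \<le> (\<Sum>(j', t') | (i, j', t') \<in> I2 n. X i j' t' * lam_coeff n lam i j t j' t') \<and>
      (X 0 0 0 - X i 0 0) * \<beta>
          \<le> (\<Sum>(j', t') | (i, j', t') \<in> I2 n. (X j' 0 0 - X i j' t') * lam_coeff n lam i j t j' t') \<and>
      (X 0 0 0 - X i 0 0) * \<beta>
          \<le> (\<Sum>(j', t') | (i, j', t') \<in> I2 n.
              (X (i + j' - 2 * t') 0 0 - X i j' t') * lam_coeff n lam i j t j' t') \<and>
      (1 - 2 * X 0 0 0 + X i 0 0) * \<beta>
          \<le> (\<Sum>(j', t') | (i, j', t') \<in> I2 n.
              (X 0 0 0 - X j' 0 0 - X (i + j' - 2 * t') 0 0 + X i j' t') * lam_coeff n lam i j t j' t')"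
  proof (intro conjI)
    show "X i 0 0 * \<beta> \<le> (\<Sum>(j', t') | (i, j', t') \<in> I2 n. X i j' t' * lam_coeff n lam i j t j' t')"
      unfolding 1
    proof (rule c)
      fix w j' t' assume "w \<in> words n" "dbar n u w = (i, j', t')"
      from X_entries[OF uv(1) this] show "X i j' t' = avg (\<lambda>\<omega>. \<chi> \<omega> zero_word * \<chi> \<omega> u * \<chi> \<omega> w)" by simp
    qed (simp add: \<chi>_def)
    show "(X 0 0 0 - X i 0 0) * \<beta>
        \<le> (\<Sum>(j', t') | (i, j', t') \<in> I2 n. (X j' 0 0 - X i j' t') * lam_coeff n lam i j t j' t')"
      unfolding 2
    proof (rule c)
      fix w j' t' assume "w \<in> words n" "dbar n u w = (i, j', t')"
      note X = X_entries[OF uv(1) this]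
      show "X j' 0 0 - X i j' t' = avg (\<lambda>\<omega>. \<chi> \<omega> zero_word * (1 - \<chi> \<omega> u) * \<chi> \<omega> w)"
        unfolding X(1,4) avg_diff[symmetric] by (simp add: algebra_simps)
    qed (simp add: \<chi>_def)
    show "(X 0 0 0 - X i 0 0) * \<beta>
        \<le> (\<Sum>(j', t') | (i, j', t') \<in> I2 n.
            (X (i + j' - 2 * t') 0 0 - X i j' t') * lam_coeff n lam i j t j' t')"
      unfolding 3
    proof (rule c)
      fix w j' t' assume "w \<in> words n" "dbar n u w = (i, j', t')"
      note X = X_entries[OF uv(1) this]
      show "X (i + j' - 2 * t') 0 0 - X i j' t' = avg (\<lambda>\<omega>. (1 - \<chi> \<omega> zero_word) * \<chi> \<omega> u * \<chi> \<omega> w)"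
        unfolding X(1,2) avg_diff[symmetric] by (simp add: algebra_simps)
    qed (simp add: \<chi>_def)
    show "(1 - 2 * X 0 0 0 + X i 0 0) * \<beta>
        \<le> (\<Sum>(j', t') | (i, j', t') \<in> I2 n.
            (X 0 0 0 - X j' 0 0 - X (i + j' - 2 * t') 0 0 + X i j' t') * lam_coeff n lam i j t j' t')"
      unfolding 4
    proof (rule c)
      fix w j' t' assume "w \<in> words n" "dbar n u w = (i, j', t')"
      note X = X_entries[OF uv(1) this]
      show "X 0 0 0 - X j' 0 0 - X (i + j' - 2 * t') 0 0 + X i j' t'
          = avg (\<lambda>\<omega>. (1 - \<chi> \<omega> zero_word) * (1 - \<chi> \<omega> u) * \<chi> \<omega> w)"
        unfolding X(1,2,4,8) avg_diff[symmetric] avg_add[symmetric] by (simp add: algebra_simps)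
    qed (simp add: \<chi>_def)
  qed
qed

lemma feasible_X: "feasible n lam \<beta> X"
  by (simp add: feasible_def constraint_A_X constraint_B_X constraint_C_X constraint_D_X)


lemma sum_\<chi>:
  assumes "\<omega> \<in> isometries n"
  shows "(\<Sum>u\<in>words n. \<chi> \<omega> u) = real (card C)"
proof -
  have "(\<Sum>u\<in>words n. \<chi> \<omega> u) = (\<Sum>u\<in>words n. of_bool (u \<in> C))"
    unfolding \<chi>_def by (rule sum.reindex_bij_betw[OF bij_betw_iso_apply[OF assms]])
  also have "\<dots> = real (card (words n \<inter> C))" by simp
  finally show ?thesis using C_words by (simp add: Int_absorb1)
qed

text \<open>The multinomials turn the sum over types into a sum over all pairs \<open>u\<close>,
  \<open>v\<close>, which is the average of \<open>\<chi> \<omega> zero_word\<close> times the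
  square of \<open>card C\<close>. By translation invariance the average at zero equals that at each
  of the \<open>2 ^ n\<close> words, so multiplying by \<open>2 ^ n\<close> gives the third factor
  \<open>card C\<close>.\<close>

lemma objective_X: "objective n X = real (card C) ^ 3"
proof -
  let ?g = "\<lambda>p. case p of (u, v) \<Rightarrow> dbar n u v" and ?W = "words n \<times> words n"
  have "(\<Sum>(i, j, t)\<in>I2 n. multinom n (i - t) (j - t) t * X i j t)
      = (\<Sum>y\<in>I2 n. real (card {p \<in> ?W. ?g p = y}) * (case y of (i, j, t) \<Rightarrow> X i j t))"
    by (rule sum.cong) (auto simp: card_pairs_dbar)
  also have "\<dots> = (\<Sum>p | p \<in> ?W \<and> ?g p \<in> I2 n. case ?g p of (i, j, t) \<Rightarrow> X i j t)"
    by (rule sum_card_fibres) auto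
  also have "\<dots> = (\<Sum>(u, v)\<in>?W. avg (\<lambda>\<omega>. \<chi> \<omega> zero_word * \<chi> \<omega> u * \<chi> \<omega> v))"
    by (rule sum.cong) (auto simp: dbar_in_I2 split: prod.split intro!: X_zero)
  also have "\<dots> = avg (\<lambda>\<omega>. \<Sum>u\<in>words n. \<Sum>v\<in>words n. \<chi> \<omega> zero_word * \<chi> \<omega> u * \<chi> \<omega> v)"
    by (simp add: avg_sum flip: sum.cartesian_product)
  also have "\<dots> = avg (\<lambda>\<omega>. (real (card C))\<^sup>2 * \<chi> \<omega> zero_word)"
  proof (rule avg_cong)
    fix \<omega> assume \<omega>: "\<omega> \<in> isometries n"
    show "(\<Sum>u\<in>words n. \<Sum>v\<in>words n. \<chi> \<omega> zero_word * \<chi> \<omega> u * \<chi> \<omega> v) = (real (card C))\<^sup>2 * \<chi> \<omega> zero_word"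
      by (simp add: sum_\<chi>[OF \<omega>] power2_eq_square flip: sum_distrib_left sum_distrib_right)
  qed
  also have "\<dots> = (real (card C))\<^sup>2 * X 0 0 0"
    by (simp add: avg_cmult X_point[OF zero_in_words])
  finally have obj: "objective n X = (real (card C))\<^sup>2 * (2 ^ n * X 0 0 0)"
    by (simp add: objective_def)
  have "2 ^ n * X 0 0 0 = (\<Sum>u\<in>words n. avg (\<lambda>\<omega>. \<chi> \<omega> u))"
    by (simp add: X_point[symmetric] card_words)
  also have "\<dots> = avg (\<lambda>\<omega>. \<Sum>u\<in>words n. \<chi> \<omega> u)" by (simp only: avg_sum)
  also have "\<dots> = avg (\<lambda>_. real (card C))"
    by (intro avg_cong sum_\<chi>)
  finally have "2 ^ n * X 0 0 0 = real (card C)" by (simp only: avg_const)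
  with obj show ?thesis by (simp add: power2_eq_square power3_eq_cube)
qed

end

text \<open>This makes the set in \<open>K2\<close> nonempty, so that its \<open>Min\<close> is
  attained. Clearing the first \<open>r\<close> coordinates of a word reaches the code within
  distance \<open>r\<close>, while a word with ones in all of them is at distance at least
  \<open>r\<close> from every codeword.\<close>

lemma has_covering_radius_initial_zeros:
  assumes "r \<le> n"
  shows "has_covering_radius n {v \<in> words n. \<forall>l<r. v l = 0} r" (is "has_covering_radius n ?C r")
  unfolding has_covering_radius_def
proof (intro conjI allI impI)
  show "(\<Union>u\<in>?C. ball_of n r u) = words n"
  proof (intro equalityI subsetI)
    fix w assume w: "w \<in> words n"
    define u where "u l = (if l < r then 0 else w l)" for l
    have "card {l. l < n \<and> u l \<noteq> w l} \<le> card {..<r}"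
      by (rule card_mono) (auto simp: u_def split: if_splits)
    moreover have "u \<in> ?C" using w assms by (auto simp: u_def words_def)
    ultimately show "w \<in> (\<Union>u\<in>?C. ball_of n r u)" using w by (auto simp: ball_of_def hamming_def)
  qed (auto simp: ball_of_def)
  fix s assume s: "s < r"
  have "word_of {..<r} \<in> words n" using assms by (intro word_of_in_words) auto
  moreover have "word_of {..<r} \<notin> ball_of n s u" if "u \<in> ?C" for u
  proof -
    have "card {..<r} \<le> card {l. l < n \<and> u l \<noteq> word_of {..<r} l}"
      using that assms by (intro card_mono) (auto simp: word_of_def)
    with s show ?thesis by (simp add: ball_of_def hamming_def)
  qed
  ultimately show "(\<Union>u\<in>?C. ball_of n s u) \<noteq> words n" by blast
qed

lemma K2_attained:
  assumes "r \<le> n"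
  obtains C where "C \<subseteq> words n" "has_covering_radius n C r" "card C = K2 n r"
proof -
  let ?S = "{C. C \<subseteq> words n \<and> has_covering_radius n C r}"
  have "finite ?S" by (rule finite_subset[of _ "Pow (words n)"]) auto
  moreover have "{v \<in> words n. \<forall>l<r. v l = 0} \<in> ?S"
    using has_covering_radius_initial_zeros[OF assms] by simp
  ultimately have "K2 n r \<in> card ` ?S" unfolding K2_def by (intro Min_in) blast+
  then show thesis using that by auto
qed

text \<open>The minimum is claimed to be attained, so the conclusion exhibits a minimizer together
  with the bound; its value is compared with that of the feasible point \<open>X\<close> of an
  optimal code.\<close>

theorem theorem4p9:
  fixes n r :: nat and lam :: "nat \<Rightarrow> real" and \<beta> :: real
  assumes "n \<ge> 1" and "r \<le> n"
    and "\<And>i. i \<le> n \<Longrightarrow> lam i \<ge> 0" and "\<beta> > 0"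
    and "\<And>C. C \<subseteq> words n \<Longrightarrow> has_covering_radius n C r \<Longrightarrow> satisfies n lam \<beta> C"
  shows "\<exists>x. is_arg_min (objective n) (feasible n lam \<beta>) x \<and>
             real (K2 n r) ^ 3 \<ge> objective n x"
proof -
  obtain C where C: "C \<subseteq> words n" "has_covering_radius n C r" "card C = K2 n r"
    using K2_attained[OF assms(2)] .
  interpret covering_code n lam \<beta> C
    using C(1) assms(5)[OF C(1,2)] by unfold_locales
  obtain x where x: "is_arg_min (objective n) (feasible n lam \<beta>) x"
    using feasible_minimum_exists[OF feasible_X] by blast
  then have "objective n x \<le> objective n X"
    using feasible_X by (auto simp: is_arg_min_def not_less)
  with x show ?thesis by (auto simp: objective_X C(3))
qed

end
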